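(* Let $s\in\mathbb{Q}$. The Laplace transform $\underline{\mathcal{L}}$ induces injective $K$-linear maps $$NGA\{\underline{x}\}_{s}^K\hookrightarrow\mathbb{C}\otimes_K NGA\Big\{\frac{1}{\underline{x}}\Big\}_{s+1}^K,\qquad NGA\Big\{\frac{1}{\underline{x}}\Big\}_{s}^K\hookrightarrow\mathbb{C}\otimes_K NGA\{\underline{x}\}_{s-1}^K.$$
   Context: $K$ is a number field, with fixed embeddings $K\hookrightarrow\mathbb{C}$ and $\overline{\mathbb{Q}}\hookrightarrow\mathbb{C}$; $d\ge1$; $\underline{x}=(x_1,\ldots,x_d)$; $|\underline\alpha|=\sum_i\alpha_i$ and $\underline\alpha!=\prod_i\alpha_i!$ for $\underline\alpha\in\mathbb{N}^d$. For $\underline\gamma\in K^d$, $\underline k\in\mathbb{N}^d$, $h_{\underline\gamma,\underline k}=\underline x^{\underline\gamma}(\log\underline x)^{\underline k}=\prod_i x_i^{\gamma_i}(\log x_i)^{k_i}$ (formal symbols, multiplied in the usual way). For a family $(a_{\underline\alpha})_{\underline\alpha\in\mathbb{N}^d}$ of algebraic numbers consider the conditions: $(A_1)$ there is a constant $C_1>0$ such that for all $\underline\alpha\in\mathbb{N}^d$, $a_{\underline\alpha}$ and its conjugates over $\mathbb{Q}$ do not exceed $C_1^{|\underline\alpha|+1}$ in absolute value; $(A_2)$ there is a constant $C_2>0$ such that for all $n\in\mathbb{N}$ the common denominator in $\mathbb{N}$ of $\{a_{\underline\alpha}:|\underline\alpha|\le n\}$ does not exceed $C_2^{n+1}$. For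 $s\in\mathbb{Q}$, $K\{\underline x\}_s$ is the set of $f=\sum_{\underline\alpha\in\mathbb{N}^d}a_{\underline\alpha}\underline x^{\underline\alpha}\in K[[\underline x]]$ such that $(a_{\underline\alpha}/(\underline\alpha!)^s)_{\underline\alpha}$ satisfies $(A_1)$ and $(A_2)$ (arithmetic Gevrey series of order $s$), and $K\{\frac1{\underline x}\}_s=\{\sum a_{\underline\alpha}\underline x^{-\underline\alpha} : \sum a_{\underline\alpha}\underline x^{\underline\alpha}\in K\{\underline x\}_s\}$. Then $NGA\{\underline x\}_s^K$ (resp. $NGA\{\frac1{\underline x}\}_s^K$) is the set of finite sums $\sum f_{\underline\gamma,\underline k}\,h_{\underline\gamma,\underline k}$ with $f_{\underline\gamma,\underline k}\in K\{\underline x\}_s$ (resp. $K\{\frac1{\underline x}\}_s$) and $(\underline\gamma,\underline k)\in(\mathbb{Q}\setminus\mathbb{Z})^d\times\mathbb{N}^d$. Elements of $\mathbb{C}\otimes_K NGA$ are regarded as formal expressions with complex coefficients. Standard Laplace transform. In one variable, for $\gamma\in K\setminus\mathbb{Z}$ and $k\in\mathbb{N}$, with $h_{\gamma,k}=x^\gamma(\log x)^k$ and $\Gamma$ Euler's Gamma function, $$\mathcal{L}(h_{\gamma,k})=\sum_{j=0}^{k}\binom{k}{j}\Gamma^{(j)}(\gamma+1)\,x^{-\gamma-1}(-1)^{k-j}(\log x)^{k-j}$$ (this is $\int_0^\infty e^{-xt}t^\gamma(\log t)^k\,dt$ when $\Re e(\gamma)>-1$, extended to all $\gamma\in K\setminus\mathbb{Z}$).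 In several variables, for $\underline\gamma\in(K\setminus\mathbb{Z})^d$, $\underline k\in\mathbb{N}^d$ and $g=\sum_{\underline\alpha}a_{\underline\alpha}\underline x^{\underline\alpha}$ with $\underline\alpha$ running over $\mathbb{N}^d$ or over $(-\mathbb{N})^d$, $\underline{\mathcal L}(g\,h_{\underline\gamma,\underline k})=\sum_{\underline\alpha}a_{\underline\alpha}\prod_{1\le i\le d}\mathcal{L}_i(h_{\gamma_i+\alpha_i,k_i})$, where $\mathcal{L}_i$ is the one-variable transform in $x_i$; $\underline{\mathcal L}$ is extended to finite sums by additivity. *)

theory Defs
  imports
    "HOL-Analysis.Analysis"
    "HOL-Library.Function_Algebras"
    "HOL-Library.Groups_Big_Fun"
begin

text \<open>A number field, identified with its image under the fixed embedding into the complex numbers.\<close>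

definition number_field :: "complex set \<Rightarrow> bool" where
  "number_field K \<longleftrightarrow>
     0 \<in> K \<and> 1 \<in> K \<and>
     (\<forall>x\<in>K. \<forall>y\<in>K. x + y \<in> K \<and> x * y \<in> K) \<and>
     (\<forall>x\<in>K. - x \<in> K \<and> inverse x \<in> K) \<and>
     (\<exists>B. finite B \<and> B \<subseteq> K \<and>
        (\<forall>x\<in>K. \<exists>c :: complex \<Rightarrow> rat. x = (\<Sum>b\<in>B. of_rat (c b) * b)))"

definition conjugate_over_Q :: "complex \<Rightarrow> complex \<Rightarrow> bool" where
  "conjugate_over_Q z w \<longleftrightarrow>
     (\<exists>p :: rat poly. irreducible p \<and>
        poly (map_poly of_rat p) z = 0 \<and> poly (map_poly of_rat p) w = 0)"

text \<open>For a finite set of algebraic numbers a common denominator exists, so \<open>LEAST\<close> is meaningful.\<close>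

definition common_denom :: "complex set \<Rightarrow> nat" where
  "common_denom A = (LEAST D. 0 < D \<and> (\<forall>a\<in>A. algebraic_int (of_nat D * a)))"

definition mdeg :: "nat ^ 'd::finite \<Rightarrow> nat" where
  "mdeg \<alpha> = (\<Sum>i\<in>UNIV. \<alpha> $ i)"

definition mfact :: "nat ^ 'd::finite \<Rightarrow> nat" where
  "mfact \<alpha> = (\<Prod>i\<in>UNIV. fact (\<alpha> $ i))"

text \<open>A number is conjugate to itself, so \<open>cond_A1\<close> also bounds \<open>a \<alpha>\<close>.\<close>

definition cond_A1 :: "(nat ^ 'd::finite \<Rightarrow> complex) \<Rightarrow> bool" where
  "cond_A1 a \<longleftrightarrow>
     (\<exists>C::real. 0 < C \<and>
        (\<forall>\<alpha> w. conjugate_over_Q (a \<alpha>) w \<longrightarrow> cmod w \<le> C ^ (mdeg \<alpha> + 1)))"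

definition cond_A2 :: "(nat ^ 'd::finite \<Rightarrow> complex) \<Rightarrow> bool" where
  "cond_A2 a \<longleftrightarrow>
     (\<exists>C::real. 0 < C \<and>
        (\<forall>n. real (common_denom {a \<alpha> |\<alpha>. mdeg \<alpha> \<le> n}) \<le> C ^ (n + 1)))"

text \<open>The rational power of the factorial is the positive real one.\<close>

definition gevrey_coeffs :: "complex set \<Rightarrow> rat \<Rightarrow> (nat ^ 'd::finite \<Rightarrow> complex) set" where
  "gevrey_coeffs K s =
     {a. (\<forall>\<alpha>. a \<alpha> \<in> K) \<and>
         cond_A1 (\<lambda>\<alpha>. a \<alpha> / of_real (real (mfact \<alpha>) powr of_rat s)) \<and>
         cond_A2 (\<lambda>\<alpha>. a \<alpha> / of_real (real (mfact \<alpha>) powr of_rat s))}"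

text \<open>Series in \<open>x\<close> and in \<open>1/x\<close> are both stored by their coefficients at the integer
  exponent vectors.\<close>

type_synonym 'd series = "int ^ 'd \<Rightarrow> complex"

definition series_of_coeffs :: "(nat ^ 'd::finite \<Rightarrow> complex) \<Rightarrow> 'd series" where
  "series_of_coeffs a = (\<lambda>\<beta>. if \<forall>i. 0 \<le> \<beta> $ i then a (\<chi> i. nat (\<beta> $ i)) else 0)"

definition gevrey :: "complex set \<Rightarrow> rat \<Rightarrow> 'd::finite series set" where
  "gevrey K s = series_of_coeffs ` gevrey_coeffs K s"

definition gevrey_inv :: "complex set \<Rightarrow> rat \<Rightarrow> 'd::finite series set" where
  "gevrey_inv K s = {\<lambda>\<beta>. g (- \<beta>) |g. g \<in> gevrey K s}"

text \<open>A formal expression \<open>\<Sum> c(\<gamma>,k) x^\<gamma> (log x)^k\<close> with complex coefficients is its coefficient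
  function \<open>c\<close>; sums are the pointwise ones. The one-variable version is \<open>expr1\<close>.\<close>

type_synonym expr1 = "complex \<times> nat \<Rightarrow> complex"
type_synonym 'd expr = "(complex ^ 'd) \<times> (nat ^ 'd) \<Rightarrow> complex"

definition scale :: "complex \<Rightarrow> ('a \<Rightarrow> complex) \<Rightarrow> 'a \<Rightarrow> complex" where
  "scale c F = (\<lambda>p. c * F p)"

text \<open>The product of one-variable expressions \<open>P i\<close>, each in its own variable \<open>x\<^sub>i\<close>.\<close>

definition prod_vars :: "('d::finite \<Rightarrow> expr1) \<Rightarrow> 'd expr" where
  "prod_vars P = (\<lambda>(\<delta>, m). \<Prod>i\<in>UNIV. P i (\<delta> $ i, m $ i))"

definition h1 :: "complex \<Rightarrow> nat \<Rightarrow> expr1" where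
  "h1 \<gamma> k = (\<lambda>p. if p = (\<gamma>, k) then 1 else 0)"

definition h :: "complex ^ 'd::finite \<Rightarrow> nat ^ 'd \<Rightarrow> 'd expr" where
  "h \<gamma> k = prod_vars (\<lambda>i. h1 (\<gamma> $ i) (k $ i))"

definition shift :: "complex ^ 'd::finite \<Rightarrow> int ^ 'd \<Rightarrow> complex ^ 'd" where
  "shift \<gamma> \<beta> = (\<chi> i. \<gamma> $ i + of_int (\<beta> $ i))"

text \<open>The product of the series \<open>g\<close> with \<open>h \<gamma> k\<close>, using \<open>x^\<beta> x^\<gamma> = x^(\<gamma>+\<beta>)\<close>. The sum is taken
  coefficientwise; for every coefficient at most one summand is nonzero.\<close>

definition times_h :: "'d::finite series \<Rightarrow> complex ^ 'd \<Rightarrow> nat ^ 'd \<Rightarrow> 'd expr" where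
  "times_h g \<gamma> k = (\<lambda>p. Sum_any (\<lambda>\<beta>. g \<beta> * h (shift \<gamma> \<beta>) k p))"

definition nonint_rat_vecs :: "(complex ^ 'd::finite) set" where
  "nonint_rat_vecs = {\<gamma>. \<forall>i. \<gamma> $ i \<in> \<rat> - \<int>}"

text \<open>Finite sums of products of a series in \<open>S\<close> with some \<open>h \<gamma> k\<close>: the space
  \<open>NGA{x}\<^sub>s\<close> for \<open>S = gevrey K s\<close>, and \<open>NGA{1/x}\<^sub>s\<close> for \<open>S = gevrey_inv K s\<close>.\<close>

definition NGA :: "'d::finite series set \<Rightarrow> 'd expr set" where
  "NGA S = {\<Sum>(\<gamma>, k)\<in>I. times_h (f (\<gamma>, k)) \<gamma> k |f I.
      finite I \<and> I \<subseteq> nonint_rat_vecs \<times> UNIV \<and> (\<forall>p\<in>I. f p \<in> S)}"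

text \<open>The extension of scalars to the complex numbers, inside the formal expressions with complex
  coefficients: for a \<open>K\<close>-space \<open>V\<close> of expressions with coefficients in \<open>K\<close>, the canonical map
  from the tensor product of the complex numbers with \<open>V\<close> over \<open>K\<close> is injective with image the
  complex span of \<open>V\<close>.\<close>

definition complexify :: "'d::finite expr set \<Rightarrow> 'd expr set" where
  "complexify V = {\<Sum>G\<in>T. scale (c G) G |c T. finite T \<and> T \<subseteq> V}"

definition linear_over :: "complex set \<Rightarrow> 'd::finite expr set \<Rightarrow> ('d expr \<Rightarrow> 'd expr) \<Rightarrow> bool" where
  "linear_over K V \<Phi> \<longleftrightarrow>
     (\<forall>F\<in>V. \<forall>G\<in>V. \<Phi> (F + G) = \<Phi> F + \<Phi> G) \<and>
     (\<forall>c\<in>K. \<forall>F\<in>V. \<Phi> (scale c F) = scale c (\<Phi> F))"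

definition laplace1 :: "complex \<Rightarrow> nat \<Rightarrow> expr1" where
  "laplace1 \<gamma> k = (\<Sum>j = 0..k.
     scale (of_nat (k choose j) * (deriv ^^ j) Gamma (\<gamma> + 1) * (- 1) ^ (k - j))
       (h1 (- \<gamma> - 1) (k - j)))"

text \<open>The transform of \<open>times_h g \<gamma> k\<close>, for \<open>g\<close> a series in \<open>x\<close> or in \<open>1/x\<close>. Again the sum is
  coefficientwise, with at most one nonzero summand.\<close>

definition laplace_times_h :: "'d::finite series \<Rightarrow> complex ^ 'd \<Rightarrow> nat ^ 'd \<Rightarrow> 'd expr" where
  "laplace_times_h g \<gamma> k =
     (\<lambda>p. Sum_any (\<lambda>\<beta>. g \<beta> * prod_vars (\<lambda>i. laplace1 (shift \<gamma> \<beta> $ i) (k $ i)) p))"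

text \<open>\<open>\<Phi>\<close> is induced by the Laplace transform on \<open>NGA S\<close>: it has the prescribed value on each
  \<open>times_h g \<gamma> k\<close>, and is extended to finite sums by additivity. At most one function on
  \<open>NGA S\<close> has this property; that one exists means that the value does not depend on the
  way an element is written as a finite sum.\<close>

definition induced_by_laplace :: "'d::finite series set \<Rightarrow> ('d expr \<Rightarrow> 'd expr) \<Rightarrow> bool" where
  "induced_by_laplace S \<Phi> \<longleftrightarrow>
     (\<forall>f I. finite I \<longrightarrow> I \<subseteq> nonint_rat_vecs \<times> UNIV \<longrightarrow> (\<forall>p\<in>I. f p \<in> S) \<longrightarrow>
        \<Phi> (\<Sum>(\<gamma>, k)\<in>I. times_h (f (\<gamma>, k)) \<gamma> k) =
          (\<Sum>(\<gamma>, k)\<in>I. laplace_times_h (f (\<gamma>, k)) \<gamma> k))"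

end

theory Submission
  imports
    Defs
    "HOL-Complex_Analysis.Cauchy_Integral_Formula"
    "HOL-Number_Theory.Cong"
begin

text \<open>
  Why the transform lands in the right space. On \<open>x\<^sup>\<gamma> (log x)\<^sup>k\<close> times a series with coefficients
  \<open>a\<^sub>\<alpha>\<close>, the Laplace transform produces, for each power \<open>m \<le> k\<close> of the logarithms, the series with
  coefficients \<open>a\<^sub>\<alpha>\<close> times a product of numbers \<open>Gamma\<^sup>(\<^sup>j\<^sup>)(\<gamma>\<^sub>i + 1 \<plusminus> \<alpha>\<^sub>i)\<close>, with exponents reflected at
  \<open>-1/2\<close>. As functions of \<open>n = \<alpha>\<^sub>i\<close> these numbers are \<open>n!\<close>, or its inverse for series in \<open>1/x\<close>, times
  a complex combination of rational sequences that grow at most geometrically and have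
  geometrically bounded common denominators (\<open>G_span_higher_deriv_Gamma\<close>). The factorial changes
  the Gevrey order by one. A rational factor with geometric bounds preserves the conditions on
  conjugates and on denominators (\<open>gevrey_coeffs_mult\<close>), and the complex scalars, which are
  polynomials in \<open>Gamma\<close> and Polygamma values at a fixed point, account for the extension of
  scalars to the complex numbers.

  For the arithmetic of the Gamma derivatives, \<open>Gamma' = Gamma \<cdot> Digamma\<close> and Leibniz's rule reduce
  everything to \<open>Gamma\<close> itself and to Polygamma functions at translates. These are governed by
  \<open>(z)\<^sub>n / n!\<close> and \<open>n! / ((z-1) ... (z-n))\<close>, and by sums of powers of \<open>1 / (z \<plusminus> k)\<close>, for a rational
  non-integer \<open>z\<close>. The denominators of the first quotient divide powers of the denominator of \<open>z\<close>
  (\<open>fact_dvd_arithmetic_progression\<close>); the other ones are controlled by a geometric bound for a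
  common multiple of \<open>1, ..., n\<close> (\<open>small_common_multiple\<close>), to which the second quotient is reduced
  by partial fractions (\<open>inverse_pochhammer_estimate\<close>).

  Why the map is well defined and injective. The coefficients of the transform are explicit finite
  linear combinations of the coefficients of the expression itself, whatever finite sum is used to
  write it (\<open>laplace_map_times_h\<close>). For a fixed exponent \<open>\<gamma>\<close> the map is triangular with respect to
  the powers of the logarithms, with diagonal entries \<open>\<plusminus> Gamma(\<gamma>\<^sub>1 + 1) ... Gamma(\<gamma>\<^sub>d + 1)\<close>, which do
  not vanish (\<open>laplace_map_kernel\<close>).
\<close>

section \<open>Small common multiples and factorials\<close>

text \<open>Expand the central binomial coefficient by Vandermonde along \<open>2n = p^L + (2n - p^L)\<close>. The
  inner terms contain \<open>p^L choose k\<close> with \<open>0 < k < p^L\<close>, a multiple of \<open>p\<close>, and the term for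
  \<open>k = 0\<close> vanishes because \<open>2n - p^L < n\<close>.\<close>

lemma prime_dvd_central_binomial:
  fixes p :: nat
  assumes "prime p" "n < p ^ L" "p ^ L \<le> 2 * n"
  shows "p dvd ((2 * n) choose n)"
proof -
  have "((2 * n) choose n) = ((p ^ L + (2 * n - p ^ L)) choose n)"
    using assms by simp
  also have "\<dots> = (\<Sum>k\<le>n. (p ^ L choose k) * ((2 * n - p ^ L) choose (n - k)))"
    by (rule vandermonde [symmetric])
  also have "p dvd \<dots>"
  proof (rule dvd_sum)
    fix k assume "k \<in> {..n}"
    then have k: "k \<le> n" by simp
    show "p dvd (p ^ L choose k) * ((2 * n - p ^ L) choose (n - k))"
    proof (cases "k = 0")
      case True
      then show ?thesis using assms by (simp add: binomial_eq_0)
    next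
      case False
      have eq: "k * (p ^ L choose k) = p ^ L * ((p ^ L - 1) choose (k - 1))"
        using False times_binomial_minus1_eq[of k "p ^ L"] by simp
      have "p dvd (p ^ L choose k)"
      proof (rule ccontr)
        assume "\<not> p dvd (p ^ L choose k)"
        then have "coprime (p ^ L) (p ^ L choose k)"
          using assms(1) by (simp add: prime_imp_coprime)
        moreover have "p ^ L dvd k * (p ^ L choose k)" using eq by simp
        ultimately have "p ^ L dvd k" by (simp add: coprime_dvd_mult_left_iff)
        then show False using False k assms(2) by (auto dest: dvd_imp_le)
      qed
      then show ?thesis by simp
    qed
  qed
  finally show ?thesis .
qed

lemma nat_prime_power_or_coprime_factors:
  fixes k :: nat
  assumes "k > 1"
  obtains (prime_power) p L where "prime p" "L > 0" "k = p ^ L"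
    | (factors) a b where "a > 1" "b > 1" "coprime a b" "k = a * b"
proof -
  obtain p where p: "prime p" "p dvd k" using assms prime_factor_nat[of k] by auto
  define L where "L = multiplicity p k"
  have L: "L > 0" unfolding L_def using p assms
    by (simp add: prime_multiplicity_gt_zero_iff)
  obtain b where b: "k = p ^ L * b" "\<not> p dvd b"
    using multiplicity_decompose'[of k p] assms p(1) unfolding L_def
    by (metis not_prime_unit not_less0 prime_gt_0_nat)
  show ?thesis
  proof (cases "b = 1")
    case True
    then show ?thesis using that(1) p L b by simp
  next
    case False
    have "b > 1" using False b assms by (cases b) auto
    moreover have "p ^ L > 1" using prime_gt_1_nat[OF p(1)] L by (rule one_less_power)
    moreover have "coprime (p ^ L) b" using p b by (simp add: prime_imp_coprime)
    ultimately show ?thesis using that(2) b by blast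
  qed
qed

text \<open>The new numbers \<open>k\<close> lie above \<open>n\<close>. If such a \<open>k\<close> is a product of two coprime factors greater
  than 1, both factors are at most \<open>n\<close> and already divide \<open>D\<close>. If it is a prime power \<open>p^L\<close>, then \<open>p^(L-1)\<close> divides \<open>D\<close> and the missing
  factor \<open>p\<close> comes from the central binomial coefficient. This replaces an estimate of Chebyshev
  type for \<open>lcm(1, ..., n)\<close>.\<close>

lemma common_multiple_double:
  fixes D n :: nat
  assumes D: "\<And>k. 0 < k \<Longrightarrow> k \<le> n \<Longrightarrow> k dvd D" and k: "0 < k" "k \<le> 2 * n"
  shows "k dvd D * ((2 * n) choose n)"
proof (cases "k \<le> n")
  case True
  then show ?thesis using D k by simp
next
  case False
  then have "k > 1" using k by simp
  then show ?thesis
  proof (cases rule: nat_prime_power_or_coprime_factors)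
    case (prime_power p L)
    then obtain l where l: "L = Suc l" by (cases L) auto
    have "p ^ l * 2 \<le> p ^ l * p"
      using prime_ge_2_nat[OF prime_power(1)] by (rule mult_le_mono2)
    moreover have "p ^ l * p \<le> 2 * n" using k prime_power l by (simp add: mult.commute)
    ultimately have "p ^ l \<le> n" by linarith
    then have "p ^ l dvd D" using D prime_power(1) by (simp add: prime_gt_0_nat)
    moreover have "p dvd ((2 * n) choose n)"
      using prime_dvd_central_binomial[of p n L] prime_power k False by simp
    ultimately show ?thesis
      unfolding prime_power(3) l power_Suc2 by (rule mult_dvd_mono)
  next
    case (factors a b)
    have "a * 2 \<le> a * b" "b * 2 \<le> b * a" using factors by (intro mult_le_mono2; simp)+
    moreover have "a * b \<le> 2 * n" "b * a \<le> 2 * n" using factors k by (simp_all add: mult.commute)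
    ultimately have "a \<le> n" "b \<le> n" by linarith+
    then have "a * b dvd D" using D factors by (intro divides_mult) auto
    then show ?thesis using factors by simp
  qed
qed

text \<open>Doubling the range costs a factor of at most \<open>4^(2^j)\<close>, and \<open>2^0 + ... + 2^(j-1) < 2^j\<close>.\<close>

lemma small_common_multiple_two_power:
  "\<exists>D::nat. 0 < D \<and> D \<le> 4 ^ (2 ^ j) \<and> (\<forall>k. 0 < k \<longrightarrow> k \<le> 2 ^ j \<longrightarrow> k dvd D)"
proof (induction j)
  case 0
  have "\<forall>k::nat. 0 < k \<longrightarrow> k \<le> 1 \<longrightarrow> k dvd 1" by (auto simp: le_Suc_eq)
  then show ?case by (intro exI[of _ 1]) simp
next
  case (Suc j)
  then obtain D :: nat where D: "0 < D" "D \<le> 4 ^ (2 ^ j)"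
      "\<And>k. 0 < k \<Longrightarrow> k \<le> 2 ^ j \<Longrightarrow> k dvd D" by blast
  define B where "B = ((2 * 2 ^ j) choose 2 ^ j :: nat)"
  have "B \<le> 2 ^ (2 * 2 ^ j)" unfolding B_def by (rule binomial_le_pow2)
  also have "\<dots> = 4 ^ (2 ^ j)" by (subst power_mult) simp
  finally have "D * B \<le> 4 ^ (2 ^ j) * 4 ^ (2 ^ j)" using D(2) by (rule mult_le_mono[rotated])
  also have "\<dots> = 4 ^ (2 ^ Suc j)" by (simp add: power_add [symmetric] mult_2)
  finally have "D * B \<le> 4 ^ (2 ^ Suc j)" .
  moreover have "D * B > 0" using D unfolding B_def by simp
  moreover have "k dvd D * B" if "0 < k" "k \<le> 2 ^ Suc j" for k
    unfolding B_def using common_multiple_double[of "2 ^ j" D k] D(3) that by simp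
  ultimately show ?case by blast
qed

lemma small_common_multiple:
  obtains D :: nat where "0 < D" "D \<le> 16 ^ n" "\<And>k. 0 < k \<Longrightarrow> k \<le> n \<Longrightarrow> k dvd D"
proof (cases "n = 0")
  case True
  then show ?thesis using that[of 1] by simp
next
  case False
  \<comment> \<open>The next power of two above \<open>n\<close> is at most \<open>2n\<close>, and \<open>4^(2n) = 16^n\<close>.\<close>
  then obtain j where j: "2 ^ j \<le> n" "n < 2 ^ (j + 1)" using ex_power_ivl1[of 2 n] by auto
  obtain D :: nat where D: "0 < D" "D \<le> 4 ^ (2 ^ Suc j)"
      "\<And>k. 0 < k \<Longrightarrow> k \<le> 2 ^ Suc j \<Longrightarrow> k dvd D"
    using small_common_multiple_two_power[of "Suc j"] by blast
  have "(4::nat) ^ (2 ^ Suc j) \<le> 4 ^ (2 * n)" using j by (intro power_increasing) auto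
  also have "\<dots> = 16 ^ n" by (subst power_mult) simp
  finally show ?thesis using D j by (intro that[of D]) auto
qed

text \<open>Only the multiples of \<open>p\<close> contribute, so the multiplicity for \<open>n\<close> is \<open>m\<close> plus the one for \<open>m\<close>,
  where \<open>m = n div p \<le> n / 2\<close>.\<close>

lemma multiplicity_fact_le:
  fixes p :: nat
  assumes p: "prime p"
  shows "multiplicity p (fact n :: nat) \<le> n"
proof (induction n rule: less_induct)
  case (less n)
  have mfact: "multiplicity p (fact m :: nat) = (\<Sum>k\<in>{1..m}. multiplicity p k)" for m
    using p unfolding fact_prod of_nat_id by (subst prime_elem_multiplicity_prod_distrib) auto
  show ?case
  proof (cases "n = 0")
    case False
    define m where "m = n div p"
    have p2: "p \<ge> 2" using p by (rule prime_ge_2_nat)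
    have m: "m \<le> n div 2" unfolding m_def using p2 by (simp add: div_le_mono2)
    have "m < n" using False p2 unfolding m_def by simp
    have mult: "multiplicity p (p * j) = 1 + multiplicity p j" if "j \<in> {1..m}" for j
      using p that by (subst prime_elem_multiplicity_mult_distrib) auto
    have im: "(\<lambda>j. p * j) ` {1..m} \<subseteq> {1..n}"
    proof
      fix k assume "k \<in> (\<lambda>j. p * j) ` {1..m}"
      then obtain j where j: "1 \<le> j" "j \<le> m" "k = p * j" by auto
      have "p * j \<le> p * m" using j by simp
      also have "\<dots> \<le> n" unfolding m_def by simp
      finally show "k \<in> {1..n}" using j p2 by simp
    qed
    have zero: "multiplicity p k = 0" if "k \<in> {1..n} - (\<lambda>j. p * j) ` {1..m}" for k
    proof (rule not_dvd_imp_multiplicity_0, rule notI)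
      assume "p dvd k"
      then obtain j where j: "k = p * j" by (auto elim: dvdE)
      have "j \<ge> 1" using that j by (cases j) auto
      moreover have "j \<le> m" using that j p2 unfolding m_def
        by (metis DiffD1 atLeastAtMost_iff div_le_mono nonzero_mult_div_cancel_left not_numeral_le_zero)
      ultimately show False using that j by auto
    qed
    have "multiplicity p (fact n :: nat) = (\<Sum>k\<in>(\<lambda>j. p * j) ` {1..m}. multiplicity p k)"
      unfolding mfact using im zero by (intro sum.mono_neutral_right) auto
    also have "\<dots> = (\<Sum>j\<in>{1..m}. multiplicity p (p * j))"
      using p2 by (subst sum.reindex) (auto simp: inj_on_def)
    also have "\<dots> = (\<Sum>j\<in>{1..m}. 1 + multiplicity p j)" using mult by (intro sum.cong) auto
    also have "\<dots> = m + multiplicity p (fact m :: nat)" unfolding mfact by (simp only: sum.distrib) simp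
    also have "\<dots> \<le> m + m" using less[OF \<open>m < n\<close>] by simp
    also have "\<dots> \<le> n" using m by simp
    finally show ?thesis .
  qed simp
qed

text \<open>Modulo a prime power coprime to \<open>q\<close> one may divide by \<open>q\<close>, which turns the product into a rising
  factorial of an integer, and that is divisible by \<open>n!\<close>. For the primes dividing \<open>q\<close> the factor
  \<open>q^n\<close> suffices, since their multiplicity in \<open>n!\<close> is at most \<open>n\<close>.\<close>

lemma fact_dvd_arithmetic_progression:
  fixes p :: int and q :: nat
  assumes q: "q > 0"
  shows "(fact n :: int) dvd int q ^ n * (\<Prod>i<n. p + int i * int q)"
proof -
  define P where "P = (\<Prod>i<n. p + int i * int q)"
  have prime_powers: "int (l ^ multiplicity l (fact n)) dvd int q ^ n * P"
    if l: "prime l" for l :: nat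
  proof (cases "l dvd q")
    case True
    have "l ^ multiplicity l (fact n) dvd l ^ n"
      using multiplicity_fact_le[OF l] by (rule le_imp_power_dvd)
    also have "\<dots> dvd q ^ n" using True by (rule dvd_power_same)
    finally have "int (l ^ multiplicity l (fact n)) dvd int (q ^ n)" by (simp only: int_dvd_int_iff)
    then show ?thesis by simp
  next
    case False
    define m where "m = int (l ^ multiplicity l (fact n))"
    have "coprime l q" using l False by (rule prime_imp_coprime)
    then have "coprime m (int q)" unfolding m_def by simp
    then obtain r where r: "[int q * r = 1] (mod m)"
      using cong_solve_coprime_int[of "int q" m] by (auto simp: coprime_commute)
    have "m dvd int (fact n)" unfolding m_def int_dvd_int_iff by (rule multiplicity_dvd)
    also have "int (fact n) dvd pochhammer (r * p) n" using fact_dvd_pochhammer[of n "r * p"] by simp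
    also have "pochhammer (r * p) n = (\<Prod>i<n. r * p + int i)"
      by (simp add: pochhammer_prod atLeast0LessThan)
    finally have "[(\<Prod>i<n. r * p + int i) = 0] (mod m)" by (simp add: cong_0_iff)
    moreover have "[(\<Prod>i<n. r * (p + int i * int q)) = (\<Prod>i<n. r * p + int i)] (mod m)"
    proof (rule cong_prod)
      fix i
      have "[r * p + int i * (int q * r) = r * p + int i * 1] (mod m)"
        using r by (intro cong_add cong_mult cong_refl)
      then show "[r * (p + int i * int q) = r * p + int i] (mod m)"
        by (simp add: algebra_simps)
    qed
    ultimately have "[(\<Prod>i<n. r * (p + int i * int q)) = 0] (mod m)" by (metis cong_trans)
    then have "m dvd r ^ n * P" unfolding P_def by (simp add: prod.distrib cong_0_iff)
    moreover have "coprime m r"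
    proof -
      have "coprime m (int q * r)" using r by (metis cong_imp_coprime cong_sym coprime_1_left coprime_commute)
      then show ?thesis by simp
    qed
    ultimately have "m dvd P" by (simp add: coprime_dvd_mult_right_iff)
    then show ?thesis unfolding m_def by simp
  qed
  have "nat \<bar>int q ^ n * P\<bar> = 0 \<or> (fact n :: nat) dvd nat \<bar>int q ^ n * P\<bar>"
  proof (cases "int q ^ n * P = 0")
    case False
    have "(fact n :: nat) dvd nat \<bar>int q ^ n * P\<bar>"
    proof (rule multiplicity_le_imp_dvd)
      fix l :: nat assume l: "prime l"
      have "l ^ multiplicity l (fact n) dvd nat \<bar>int q ^ n * P\<bar>"
        using prime_powers[OF l] by (metis int_dvd_int_iff dvd_abs_iff int_nat_eq abs_ge_zero)
      then show "multiplicity l (fact n :: nat) \<le> multiplicity l (nat \<bar>int q ^ n * P\<bar>)"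
        using l False by (intro multiplicity_geI) auto
    qed simp
    then show ?thesis ..
  qed simp
  then have "int (fact n) dvd int (nat \<bar>int q ^ n * P\<bar>)" by (metis dvd_0_right int_dvd_int_iff)
  then show ?thesis unfolding P_def by simp
qed

section \<open>Families with geometric size and geometric common denominators\<close>

text \<open>These are the growth conditions on the coefficients of a G-function with rational coefficients,
  for families indexed by any type with a size function \<open>w\<close>: one instance is sequences with
  \<open>w n = n\<close>, the other is families over multi-indices with \<open>w = mdeg\<close>. One constant \<open>C\<close> serves
  both conditions. The second one forces the values to be rational.\<close>

definition G_bounded :: "('a \<Rightarrow> nat) \<Rightarrow> ('a \<Rightarrow> complex) \<Rightarrow> bool" where
  "G_bounded w r \<longleftrightarrow>
     (\<exists>C::real. 1 \<le> C \<and> (\<forall>x. cmod (r x) \<le> C ^ (w x + 1)) \<and>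
        (\<forall>n. \<exists>D::nat. 0 < D \<and> real D \<le> C ^ (n + 1) \<and>
           (\<forall>x. w x \<le> n \<longrightarrow> of_nat D * r x \<in> \<int>)))"

text \<open>Separate constants, and a factor in front of the geometric term, are absorbed into one constant.\<close>

lemma G_boundedI:
  fixes A B A' B' :: real
  assumes r: "\<And>x. cmod (r x) \<le> A * B ^ w x"
    and D: "\<And>n. \<exists>D::nat. 0 < D \<and> real D \<le> A' * B' ^ n \<and> (\<forall>x. w x \<le> n \<longrightarrow> of_nat D * r x \<in> \<int>)"
  shows "G_bounded w r"
proof -
  define C where "C = 1 + \<bar>A\<bar> + \<bar>B\<bar> + \<bar>A'\<bar> + \<bar>B'\<bar>"
  have est: "X * Y ^ n \<le> C ^ (n + 1)" if "\<bar>X\<bar> \<le> C" "\<bar>Y\<bar> \<le> C" for X Y :: real and n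
  proof -
    have "X * Y ^ n \<le> \<bar>X\<bar> * \<bar>Y\<bar> ^ n" by (metis abs_ge_self abs_mult power_abs)
    also have "\<dots> \<le> C * C ^ n" using that by (intro mult_mono power_mono) auto
    finally show ?thesis by simp
  qed
  have C: "1 \<le> C" "\<bar>A\<bar> \<le> C" "\<bar>B\<bar> \<le> C" "\<bar>A'\<bar> \<le> C" "\<bar>B'\<bar> \<le> C" unfolding C_def by simp_all
  show ?thesis
    unfolding G_bounded_def
  proof (intro exI[of _ C] conjI allI)
    show "cmod (r x) \<le> C ^ (w x + 1)" for x
      using r[of x] est[OF C(2,3), of "w x"] by linarith
    show "\<exists>D::nat. 0 < D \<and> real D \<le> C ^ (n + 1) \<and> (\<forall>x. w x \<le> n \<longrightarrow> of_nat D * r x \<in> \<int>)" for n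
      using D[of n] est[OF C(4,5), of n] by (meson order_trans)
  qed (rule C)
qed

lemma G_boundedE:
  assumes "G_bounded w r"
  obtains C :: real and D :: "nat \<Rightarrow> nat" where "1 \<le> C" "\<And>x. cmod (r x) \<le> C ^ (w x + 1)"
    "\<And>n. 0 < D n" "\<And>n. real (D n) \<le> C ^ (n + 1)" "\<And>n x. w x \<le> n \<Longrightarrow> of_nat (D n) * r x \<in> \<int>"
  using assms unfolding G_bounded_def by metis

lemma G_bounded_mult:
  assumes "G_bounded w r" "G_bounded w r'"
  shows "G_bounded w (\<lambda>x. r x * r' x)"
proof -
  obtain C D where C: "1 \<le> C" "\<And>x. cmod (r x) \<le> C ^ (w x + 1)"
    "\<And>n. 0 < D n" "\<And>n. real (D n) \<le> C ^ (n + 1)" "\<And>n x. w x \<le> n \<Longrightarrow> of_nat (D n) * r x \<in> \<int>"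
    using assms(1) by (rule G_boundedE) (rule that)
  obtain C' D' where C': "1 \<le> C'" "\<And>x. cmod (r' x) \<le> C' ^ (w x + 1)"
    "\<And>n. 0 < D' n" "\<And>n. real (D' n) \<le> C' ^ (n + 1)"
    "\<And>n x. w x \<le> n \<Longrightarrow> of_nat (D' n) * r' x \<in> \<int>"
    using assms(2) by (rule G_boundedE) (rule that)
  show ?thesis
  proof (rule G_boundedI)
    fix x
    have "cmod (r x * r' x) \<le> C ^ (w x + 1) * C' ^ (w x + 1)"
      unfolding norm_mult using C C' by (intro mult_mono) auto
    then show "cmod (r x * r' x) \<le> (C * C') * (C * C') ^ w x" by (simp add: power_mult_distrib mult_ac)
  next
    fix n
    have "real (D n * D' n) \<le> C ^ (n + 1) * C' ^ (n + 1)"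
      unfolding of_nat_mult using C C' by (intro mult_mono) auto
    then have "real (D n * D' n) \<le> (C * C') * (C * C') ^ n" by (simp add: power_mult_distrib mult_ac)
    moreover have "of_nat (D n * D' n) * (r x * r' x) \<in> \<int>" if "w x \<le> n" for x
      using Ints_mult[OF C(5)[OF that] C'(5)[OF that]] by (simp add: mult_ac)
    ultimately show "\<exists>D::nat. 0 < D \<and> real D \<le> (C * C') * (C * C') ^ n \<and>
        (\<forall>x. w x \<le> n \<longrightarrow> of_nat D * (r x * r' x) \<in> \<int>)"
      using C(3) C'(3) by (intro exI[of _ "D n * D' n"]) auto
  qed
qed

text \<open>The number of summands is at most \<open>2^n\<close>, and a common denominator for the terms up to index \<open>n\<close>
  also serves all their partial sums.\<close>

lemma G_bounded_partial_sums:
  assumes "G_bounded (\<lambda>n. n) r"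
  shows "G_bounded (\<lambda>n. n) (\<lambda>n. \<Sum>k<n. r k)"
proof -
  obtain C D where C: "1 \<le> C" "\<And>x. cmod (r x) \<le> C ^ (x + 1)"
    "\<And>n. 0 < D n" "\<And>n. real (D n) \<le> C ^ (n + 1)" "\<And>n x. x \<le> n \<Longrightarrow> of_nat (D n) * r x \<in> \<int>"
    using assms by (rule G_boundedE) (rule that)
  show ?thesis
  proof (rule G_boundedI)
    fix n :: nat
    have "cmod (\<Sum>k<n. r k) \<le> (\<Sum>k<n. C ^ n)"
    proof (rule sum_norm_le)
      fix k assume "k \<in> {..<n}"
      then have "C ^ (k + 1) \<le> C ^ n" using C(1) by (intro power_increasing) auto
      then show "cmod (r k) \<le> C ^ n" using C(2)[of k] by linarith
    qed
    also have "\<dots> = real n * C ^ n" by simp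
    also have "\<dots> \<le> 2 ^ n * C ^ n" using C(1) of_nat_less_two_power[of n, where 'a=real]
      by (intro mult_right_mono) auto
    finally show "cmod (\<Sum>k<n. r k) \<le> 1 * (2 * C) ^ n" by (simp add: power_mult_distrib)
  next
    fix n :: nat
    have "of_nat (D n) * (\<Sum>k<m. r k) \<in> \<int>" if "m \<le> n" for m
      unfolding sum_distrib_left using C(5) that by (intro Ints_sum) auto
    then show "\<exists>D::nat. 0 < D \<and> real D \<le> C * C ^ n \<and>
        (\<forall>m. m \<le> n \<longrightarrow> of_nat D * (\<Sum>k<m. r k) \<in> \<int>)"
      using C(3,4) by (intro exI[of _ "D n"]) auto
  qed
qed

lemma G_bounded_const:
  assumes "c \<in> \<rat>"
  shows "G_bounded w (\<lambda>x. c)"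
proof -
  obtain a b where ab: "b > 0" "c = of_int a / of_int b" using assms by (rule Rats_cases')
  show ?thesis
  proof (rule G_boundedI)
    show "cmod c \<le> cmod c * 1 ^ w x" for x by simp
    show "\<exists>D::nat. 0 < D \<and> real D \<le> real (nat b) * 1 ^ n \<and> (\<forall>x. w x \<le> n \<longrightarrow> of_nat D * c \<in> \<int>)" for n
      using ab by (intro exI[of _ "nat b"]) auto
  qed
qed

lemma G_bounded_power: "G_bounded w r \<Longrightarrow> G_bounded w (\<lambda>x. r x ^ n)"
  by (induction n) (auto intro: G_bounded_mult G_bounded_const)

lemma G_bounded_pullback:
  assumes "G_bounded w r" "\<And>x. w (\<phi> x) \<le> w' x"
  shows "G_bounded w' (\<lambda>x. r (\<phi> x))"
proof -
  obtain C D where C: "1 \<le> C" "\<And>x. cmod (r x) \<le> C ^ (w x + 1)"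
    "\<And>n. 0 < D n" "\<And>n. real (D n) \<le> C ^ (n + 1)" "\<And>n x. w x \<le> n \<Longrightarrow> of_nat (D n) * r x \<in> \<int>"
    using assms(1) by (rule G_boundedE) (rule that)
  show ?thesis
  proof (rule G_boundedI)
    fix x
    have "cmod (r (\<phi> x)) \<le> C ^ (w (\<phi> x) + 1)" by (rule C)
    also have "\<dots> \<le> C ^ (w' x + 1)" using C(1) assms(2) by (intro power_increasing) auto
    finally show "cmod (r (\<phi> x)) \<le> C * C ^ w' x" by simp
  next
    show "\<exists>D::nat. 0 < D \<and> real D \<le> C * C ^ n \<and>
        (\<forall>x. w' x \<le> n \<longrightarrow> of_nat D * r (\<phi> x) \<in> \<int>)" for n
      using C(3,4) C(5)[OF order_trans[OF assms(2)]] by (intro exI[of _ "D n"]) auto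
  qed
qed

text \<open>The complex span of the \<open>G_bounded\<close> families. It is an algebra, so transcendental constants such
  as the derivatives of Gamma at a fixed point may enter as scalars while the dependence on the
  index stays arithmetic.\<close>

inductive G_span :: "('a \<Rightarrow> nat) \<Rightarrow> ('a \<Rightarrow> complex) \<Rightarrow> bool" for w where
  G_span_base: "G_bounded w r \<Longrightarrow> G_span w r"
| G_span_add: "G_span w f \<Longrightarrow> G_span w g \<Longrightarrow> G_span w (\<lambda>x. f x + g x)"
| G_span_cmult: "G_span w f \<Longrightarrow> G_span w (\<lambda>x. c * f x)"

lemma G_span_const: "G_span w (\<lambda>x. c)"
  using G_span_cmult[OF G_span_base[OF G_bounded_const[of 1 w]], of c] by simp

lemma G_span_mult:
  assumes "G_span w f" "G_span w g"
  shows "G_span w (\<lambda>x. f x * g x)"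
  using assms(1)
proof induction
  case (G_span_base r)
  from assms(2) show ?case
  proof induction
    case (G_span_base r')
    then show ?case using \<open>G_bounded w r\<close> by (intro G_span.G_span_base G_bounded_mult)
  next
    case (G_span_add f g)
    then show ?case using G_span.G_span_add by (fastforce simp: distrib_left)
  next
    case (G_span_cmult f c)
    then show ?case using G_span.G_span_cmult[OF G_span_cmult(2), of c] by (simp add: mult_ac)
  qed
next
  case (G_span_add f1 f2)
  then show ?case using G_span.G_span_add by (fastforce simp: distrib_right)
next
  case (G_span_cmult f c)
  then show ?case using G_span.G_span_cmult[OF G_span_cmult(2), of c] by (simp add: mult_ac)
qed

lemma G_span_sum: "(\<And>i. i \<in> I \<Longrightarrow> G_span w (f i)) \<Longrightarrow> G_span w (\<lambda>x. \<Sum>i\<in>I. f i x)"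
  by (induction I rule: infinite_finite_induct) (auto intro: G_span_const G_span_add)

lemma G_span_prod: "(\<And>i. i \<in> I \<Longrightarrow> G_span w (f i)) \<Longrightarrow> G_span w (\<lambda>x. \<Prod>i\<in>I. f i x)"
  by (induction I rule: infinite_finite_induct) (auto intro: G_span_const G_span_mult)

lemma G_span_pullback:
  assumes "G_span w f" "\<And>x. w (\<phi> x) \<le> w' x"
  shows "G_span w' (\<lambda>x. f (\<phi> x))"
  using assms(1)
proof induction
  case (G_span_base r)
  then show ?case using assms(2) by (intro G_span.G_span_base G_bounded_pullback[of w r \<phi>])
qed (auto intro: G_span.intros)

section \<open>Reciprocals and rising factorials at a non-integer rational\<close>

lemma rat_nonint_fraction:
  fixes z :: complex
  assumes "z \<in> \<rat> - \<int>"
  obtains p :: int and q :: nat where "q > 0" "z = of_int p / of_nat q"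
    "\<And>k. p + k * int q \<noteq> 0" "\<And>k. z + of_int k \<noteq> 0"
proof -
  obtain p b where b: "b > 0" "z = of_int p / of_int b" using assms by (blast elim: Rats_cases')
  have z: "z + of_int k \<noteq> 0" for k :: int
  proof
    assume "z + of_int k = 0"
    then have "z = of_int (- k)" by (simp add: eq_neg_iff_add_eq_0)
    then show False using assms by simp
  qed
  have eq: "z + of_int k = of_int (p + k * int (nat b)) / of_nat (nat b)" for k
    using b by (simp add: field_simps)
  have "p + k * int (nat b) \<noteq> 0" for k
  proof
    assume "p + k * int (nat b) = 0"
    then show False using z[of k] unfolding eq by simp
  qed
  then show ?thesis using b z by (intro that[of "nat b" p]) simp_all
qed

text \<open>With \<open>z = p / q\<close> one has \<open>1 / (z + k) = q / (p + k q)\<close>. The denominator is a nonzero integer of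
  absolute value at most \<open>\<bar>p\<bar> + n q\<close>, and all integers up to that bound have a common multiple
  that is geometric in \<open>n\<close>.\<close>

lemma reciprocal_denominators:
  fixes z :: complex
  assumes z: "z \<in> \<rat> - \<int>"
  obtains A B C :: real where
    "\<And>k::int. cmod (1 / (z + of_int k)) \<le> C"
    "\<And>n::nat. \<exists>D::nat. 0 < D \<and> real D \<le> A * B ^ n \<and>
       (\<forall>k::int. \<bar>k\<bar> \<le> int n \<longrightarrow> of_nat D / (z + of_int k) \<in> \<int>)"
proof -
  obtain p :: int and q :: nat where pq: "q > 0" "z = of_int p / of_nat q"
    "\<And>k. p + k * int q \<noteq> 0" "\<And>k. z + of_int k \<noteq> 0"
    by (rule rat_nonint_fraction[OF z]) (rule that)
  have eq: "1 / (z + of_int k) = of_nat q / of_int (p + k * int q)" for k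
  proof -
    have "z + of_int k = of_int (p + k * int q) / of_nat q" using pq(1,2) by (simp add: field_simps)
    then show ?thesis by simp
  qed
  show ?thesis
  proof (rule that)
    fix k :: int
    have "1 \<le> \<bar>p + k * int q\<bar>" using pq(3)[of k] by linarith
    then have "1 \<le> \<bar>real_of_int (p + k * int q)\<bar>" by linarith
    then have "real q / \<bar>real_of_int (p + k * int q)\<bar> \<le> real q / 1"
      by (intro divide_left_mono) auto
    then show "cmod (1 / (z + of_int k)) \<le> real q"
      unfolding eq by (simp only: norm_divide norm_of_nat norm_of_int)
  next
    fix n :: nat
    obtain D :: nat where D: "0 < D" "D \<le> 16 ^ (nat \<bar>p\<bar> + n * q)"
      "\<And>k. 0 < k \<Longrightarrow> k \<le> nat \<bar>p\<bar> + n * q \<Longrightarrow> k dvd D"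
      using small_common_multiple by blast
    have "real D \<le> real (16 ^ (nat \<bar>p\<bar> + n * q))" using D(2) by (simp only: of_nat_le_iff)
    also have "\<dots> = 16 ^ nat \<bar>p\<bar> * (16 ^ q) ^ n"
      by (simp add: power_add power_mult [symmetric] mult.commute)
    finally have "real D \<le> 16 ^ nat \<bar>p\<bar> * (16 ^ q) ^ n" .
    moreover have "of_nat D / (z + of_int k) \<in> \<int>" if k: "\<bar>k\<bar> \<le> int n" for k
    proof -
      define m where "m = p + k * int q"
      have "\<bar>m\<bar> \<le> \<bar>p\<bar> + \<bar>k * int q\<bar>" unfolding m_def by linarith
      also have "\<bar>k * int q\<bar> \<le> int n * int q" using k by (simp add: abs_mult mult_right_mono)
      finally have "nat \<bar>m\<bar> \<le> nat \<bar>p\<bar> + n * q" by (simp add: nat_le_iff)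
      then have "nat \<bar>m\<bar> dvd D" using D(3)[of "nat \<bar>m\<bar>"] pq(3)[of k] unfolding m_def by simp
      then have "m dvd int D" by (simp add: nat_abs_dvd_iff)
      then obtain t where t: "int D = m * t" by (elim dvdE)
      have "(of_nat D :: complex) = of_int m * of_int t" using t by (metis of_int_mult of_int_of_nat_eq)
      then have "of_nat D / (z + of_int k) = of_int m * of_int t * (1 / (z + of_int k))" by simp
      also have "\<dots> = of_int (int q * t)"
        unfolding eq m_def [symmetric] using pq(3)[of k] unfolding m_def [symmetric] by simp
      finally show ?thesis by simp
    qed
    ultimately show "\<exists>D::nat. 0 < D \<and> real D \<le> 16 ^ nat \<bar>p\<bar> * (16 ^ q) ^ n \<and>
       (\<forall>k::int. \<bar>k\<bar> \<le> int n \<longrightarrow> of_nat D / (z + of_int k) \<in> \<int>)"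
      using D(1) by blast
  qed
qed

lemma G_bounded_reciprocals:
  fixes e :: int
  assumes z: "z \<in> \<rat> - \<int>" and e: "\<bar>e\<bar> = 1"
  shows "G_bounded (\<lambda>n. n) (\<lambda>n. 1 / (z + of_int (e * int n)))"
proof -
  obtain A B C :: real where *:
    "\<And>k::int. cmod (1 / (z + of_int k)) \<le> C"
    "\<And>n::nat. \<exists>D::nat. 0 < D \<and> real D \<le> A * B ^ n \<and>
       (\<forall>k::int. \<bar>k\<bar> \<le> int n \<longrightarrow> of_nat D / (z + of_int k) \<in> \<int>)"
    by (rule reciprocal_denominators[OF z]) (rule that)
  show ?thesis
  proof (rule G_boundedI)
    show "cmod (1 / (z + of_int (e * int n))) \<le> C * 1 ^ n" for n
      using *(1)[of "e * int n"] by simp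
    show "\<exists>D::nat. 0 < D \<and> real D \<le> A * B ^ n \<and>
        (\<forall>m\<le>n. of_nat D * (1 / (z + of_int (e * int m))) \<in> \<int>)" for n
    proof -
      obtain D :: nat where D: "0 < D" "real D \<le> A * B ^ n"
          "\<And>k::int. \<bar>k\<bar> \<le> int n \<Longrightarrow> of_nat D / (z + of_int k) \<in> \<int>" using *(2)[of n] by blast
      have "of_nat D * (1 / (z + of_int (e * int m))) \<in> \<int>" if "m \<le> n" for m
        using D(3)[of "e * int m"] that e by (simp add: abs_mult)
      then show ?thesis using D by blast
    qed
  qed
qed

text \<open>The factors \<open>(z + i) / (i + 1)\<close> are bounded, and for \<open>z = p / q\<close> the number
  \<open>q^(2n)\<close> clears the denominator because \<open>n!\<close> divides \<open>q^n\<close> times the product of the \<open>p + i q\<close>.\<close>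

lemma G_bounded_pochhammer:
  assumes z: "z \<in> \<rat> - \<int>"
  shows "G_bounded (\<lambda>n. n) (\<lambda>n. pochhammer z n / fact n)"
proof -
  obtain p :: int and q :: nat where pq: "q > 0" "z = of_int p / of_nat q"
    by (rule rat_nonint_fraction[OF z]) (rule that)
  show ?thesis
  proof (rule G_boundedI)
    fix n :: nat
    have "cmod (pochhammer z n / fact n) \<le> (cmod z + 1) ^ n"
    proof (induction n)
      case (Suc n)
      have "cmod (z + of_nat n) \<le> cmod z + real n" using norm_triangle_ineq[of z "of_nat n"] by simp
      also have "\<dots> \<le> (cmod z + 1) * real (Suc n)" by (simp add: algebra_simps)
      finally have "cmod ((z + of_nat n) / of_nat (Suc n)) \<le> cmod z + 1"
        unfolding norm_divide norm_of_nat by (simp add: divide_le_eq)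
      then have "cmod (pochhammer z n / fact n) * cmod ((z + of_nat n) / of_nat (Suc n)) \<le>
          (cmod z + 1) ^ n * (cmod z + 1)" using Suc by (intro mult_mono) auto
      then show ?case by (simp add: pochhammer_Suc norm_mult norm_divide mult_ac)
    qed simp
    then show "cmod (pochhammer z n / fact n) \<le> 1 * (cmod z + 1) ^ n" by simp
  next
    fix n :: nat
    \<comment> \<open>One factor \<open>q^m\<close> clears the denominators of the \<open>z + i\<close>, a second one is spent on \<open>m!\<close>.\<close>
    have int: "of_nat (q ^ (2 * n)) * (pochhammer z m / fact m) \<in> \<int>" if "m \<le> n" for m
    proof -
      have eq: "of_nat q ^ m * pochhammer z m = of_int (\<Prod>i<m. p + int i * int q)"
      proof -
        have "of_nat q ^ m * pochhammer z m = (\<Prod>i<m. of_nat q * (z + of_nat i))"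
          by (simp add: pochhammer_prod atLeast0LessThan prod.distrib)
        also have "\<dots> = (\<Prod>i<m. of_int (p + int i * int q))"
          using pq by (intro prod.cong) (auto simp: field_simps)
        finally show ?thesis by simp
      qed
      obtain t where t: "int q ^ m * (\<Prod>i<m. p + int i * int q) = fact m * t"
        using fact_dvd_arithmetic_progression[OF pq(1), of m p] by (elim dvdE)
      have "of_nat q ^ (2 * m) * pochhammer z m = of_nat q ^ m * (of_nat q ^ m * pochhammer z m)"
        by (simp add: mult_2 power_add)
      also have "\<dots> = of_int (int q ^ m * (\<Prod>i<m. p + int i * int q))" unfolding eq by simp
      also have "\<dots> = fact m * of_int t" unfolding t by simp
      finally have "of_nat q ^ (2 * m) * (pochhammer z m / fact m) = of_int t" by simp
      moreover have "(of_nat (q ^ (2 * n)) :: complex) = of_nat q ^ (2 * (n - m)) * of_nat q ^ (2 * m)"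
      proof -
        have "2 * n = 2 * (n - m) + 2 * m" using that by simp
        then show ?thesis by (metis of_nat_power power_add)
      qed
      ultimately have "of_nat (q ^ (2 * n)) * (pochhammer z m / fact m) =
          of_nat (q ^ (2 * (n - m))) * of_int t" by (simp only: mult.assoc of_nat_power)
      then show ?thesis by simp
    qed
    have "real (q ^ (2 * n)) = 1 * (real q ^ 2) ^ n" by (simp add: power_mult)
    with int pq(1) show "\<exists>D::nat. 0 < D \<and> real D \<le> 1 * (real q ^ 2) ^ n \<and>
        (\<forall>m\<le>n. of_nat D * (pochhammer z m / fact m) \<in> \<int>)"
      by (intro exI[of _ "q ^ (2 * n)"]) auto
  qed
qed

text \<open>The quotient on the left is \<open>(n + 1)! / ((z - 1) ... (z - n - 2))\<close>; the identity is
  \<open>(z - 1) - (z - n - 2) = n + 1\<close>, multiplied by \<open>n!\<close> and divided by the full product. Iterating it yields the partial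
  fraction decomposition with integer coefficients without having to write it down.\<close>

lemma inverse_pochhammer_step:
  fixes z :: complex
  assumes "\<And>k::int. z + of_int k \<noteq> 0"
  shows "fact (Suc n) / pochhammer (z - of_nat (Suc (Suc n))) (Suc (Suc n)) =
    fact n / pochhammer (z - 1 - of_nat (Suc n)) (Suc n) - fact n / pochhammer (z - of_nat (Suc n)) (Suc n)"
proof -
  define y where "y = z - of_nat (Suc (Suc n))"
  define P where "P = pochhammer (y + 1) n"
  have nz: "y + of_int k \<noteq> 0" for k :: int
    using assms[of "k - int (Suc (Suc n))"] unfolding y_def by (simp add: algebra_simps)
  have P: "P \<noteq> 0" unfolding P_def
  proof
    assume "pochhammer (y + 1) n = 0"
    then obtain k where "y + 1 = - of_nat k" by (auto simp: pochhammer_eq_0_iff)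
    moreover have "y + of_int (1 + int k) = (y + 1) + of_nat k" by simp
    ultimately have "y + of_int (1 + int k) = 0" by simp
    then show False using nz by blast
  qed
  have y: "y \<noteq> 0" "y + 1 + of_nat n \<noteq> 0" using nz[of 0] nz[of "1 + int n"] by (simp_all add: add_ac)
  have 1: "pochhammer (z - of_nat (Suc (Suc n))) (Suc (Suc n)) = y * (P * (y + 1 + of_nat n))"
    unfolding y_def [symmetric] P_def by (subst pochhammer_rec) (simp add: pochhammer_Suc)
  have "z - 1 - of_nat (Suc n) = y" unfolding y_def by simp
  then have 2: "pochhammer (z - 1 - of_nat (Suc n)) (Suc n) = y * P"
    unfolding P_def by (simp add: pochhammer_rec)
  have "z - of_nat (Suc n) = y + 1" unfolding y_def by simp
  then have 3: "pochhammer (z - of_nat (Suc n)) (Suc n) = P * (y + 1 + of_nat n)"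
    unfolding P_def by (simp only: pochhammer_Suc)
  define u where "u = y + 1 + of_nat n"
  have "fact (Suc n) = (u - y) * fact n" unfolding u_def by (simp add: algebra_simps)
  then show ?thesis
    unfolding 1 2 3 u_def [symmetric] using P y unfolding u_def [symmetric] by (simp add: field_simps)
qed

text \<open>By the recursion the quotient is an integer combination of the \<open>1 / (z - i)\<close> with \<open>1 \<le> i \<le> n + 1\<close>
  whose coefficients have total absolute value at most \<open>2^n\<close>. Hence a common denominator of these
  reciprocals is enough.\<close>

lemma inverse_pochhammer_estimate:
  fixes z :: complex and C :: real
  assumes nz: "\<And>k::int. z + of_int k \<noteq> 0"
    and C: "\<And>k::int. cmod (1 / (z + of_int k)) \<le> C"
    and D: "\<And>i. i \<le> n \<Longrightarrow> of_nat D / (z - of_nat (Suc i)) \<in> \<int>"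
  shows "cmod (fact n / pochhammer (z - of_nat (Suc n)) (Suc n)) \<le> 2 ^ n * C \<and>
    of_nat D * (fact n / pochhammer (z - of_nat (Suc n)) (Suc n)) \<in> \<int>"
  using assms
proof (induction n arbitrary: z)
  case 0
  then show ?case using "0.prems"(2)[of "-1"] "0.prems"(3)[of 0] by simp
next
  case (Suc n)
  have a: "cmod (fact n / pochhammer (z - of_nat (Suc n)) (Suc n)) \<le> 2 ^ n * C \<and>
    of_nat D * (fact n / pochhammer (z - of_nat (Suc n)) (Suc n)) \<in> \<int>"
    using Suc.prems by (intro Suc.IH) auto
  have b: "cmod (fact n / pochhammer (z - 1 - of_nat (Suc n)) (Suc n)) \<le> 2 ^ n * C \<and>
    of_nat D * (fact n / pochhammer (z - 1 - of_nat (Suc n)) (Suc n)) \<in> \<int>"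
  proof (rule Suc.IH)
    have sh: "z - 1 + of_int k = z + of_int (k - 1)" for k :: int by simp
    show "z - 1 + of_int k \<noteq> 0" "cmod (1 / (z - 1 + of_int k)) \<le> C" for k
      unfolding sh by (rule Suc.prems)+
    show "of_nat D / (z - 1 - of_nat (Suc i)) \<in> \<int>" if "i \<le> n" for i
      using Suc.prems(3)[of "Suc i"] that by (simp add: algebra_simps)
  qed
  show ?case
    unfolding inverse_pochhammer_step[OF Suc.prems(1)]
  proof
    show "cmod (fact n / pochhammer (z - 1 - of_nat (Suc n)) (Suc n) -
        fact n / pochhammer (z - of_nat (Suc n)) (Suc n)) \<le> 2 ^ Suc n * C"
      using a b norm_triangle_ineq4[of "fact n / pochhammer (z - 1 - of_nat (Suc n)) (Suc n)"
        "fact n / pochhammer (z - of_nat (Suc n)) (Suc n)"] by simp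
    show "of_nat D * (fact n / pochhammer (z - 1 - of_nat (Suc n)) (Suc n) -
        fact n / pochhammer (z - of_nat (Suc n)) (Suc n)) \<in> \<int>"
      unfolding right_diff_distrib using a b by (intro Ints_diff) auto
  qed
qed

text \<open>The denominators come from the reciprocals \<open>1 / (z - i)\<close>. The previous estimate carries
  \<open>(n - 1)!\<close> in the numerator, and the remaining factor \<open>n\<close> is at most \<open>2^n\<close>.\<close>

lemma G_bounded_inverse_pochhammer:
  assumes z: "z \<in> \<rat> - \<int>"
  shows "G_bounded (\<lambda>n. n) (\<lambda>n. fact n / pochhammer (z - of_nat n) n)"
proof -
  obtain A B C :: real where *:
    "\<And>k::int. cmod (1 / (z + of_int k)) \<le> C"
    "\<And>n::nat. \<exists>D::nat. 0 < D \<and> real D \<le> A * B ^ n \<and>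
       (\<forall>k::int. \<bar>k\<bar> \<le> int n \<longrightarrow> of_nat D / (z + of_int k) \<in> \<int>)"
    by (rule reciprocal_denominators[OF z]) (rule that)
  have nz: "\<And>k::int. z + of_int k \<noteq> 0" using rat_nonint_fraction[OF z] by metis
  have C0: "C \<ge> 0" using *(1)[of 0] norm_ge_zero order_trans by blast
  have fact_split: "fact (Suc m) / X = of_nat (Suc m) * (fact m / X)" for m and X :: complex
    by (simp add: field_simps)
  have step: "cmod (fact m / pochhammer (z - of_nat m) m) \<le> (C + 1) * 4 ^ m \<and>
      of_nat D * (fact m / pochhammer (z - of_nat m) m) \<in> \<int>"
    if D: "\<And>k::int. \<bar>k\<bar> \<le> int m \<Longrightarrow> of_nat D / (z + of_int k) \<in> \<int>" for m D
  proof (cases m)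
    case 0
    then show ?thesis using C0 by simp
  next
    case (Suc m')
    have "of_nat D / (z - of_nat (Suc i)) \<in> \<int>" if "i \<le> m'" for i
      using D[of "- int (Suc i)"] that Suc by (simp add: algebra_simps)
    then have e: "cmod (fact m' / pochhammer (z - of_nat (Suc m')) (Suc m')) \<le> 2 ^ m' * C"
      "of_nat D * (fact m' / pochhammer (z - of_nat (Suc m')) (Suc m')) \<in> \<int>"
      using inverse_pochhammer_estimate[of z C m' D] nz *(1) by auto
    have "cmod (of_nat m * (fact m' / pochhammer (z - of_nat (Suc m')) (Suc m'))) \<le> 2 ^ m * (2 ^ m' * C)"
      unfolding norm_mult norm_of_nat
      using e(1) of_nat_less_two_power[of m, where 'a=real] by (intro mult_mono) auto
    also have "\<dots> \<le> 2 ^ m * (2 ^ m * (C + 1))"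
      using C0 Suc by (intro mult_left_mono mult_mono power_increasing) auto
    also have "\<dots> = (C + 1) * 4 ^ m" by (simp add: power_mult_distrib [symmetric])
    finally have "cmod (fact m / pochhammer (z - of_nat m) m) \<le> (C + 1) * 4 ^ m"
      unfolding Suc fact_split .
    moreover have "of_nat D * (fact m / pochhammer (z - of_nat m) m) \<in> \<int>"
      unfolding Suc fact_split using Ints_mult[OF Ints_of_nat[of "Suc m'"] e(2)] by (simp only: mult_ac)
    ultimately show ?thesis ..
  qed
  show ?thesis
  proof (rule G_boundedI)
    fix n :: nat
    show "cmod (fact n / pochhammer (z - of_nat n) n) \<le> (C + 1) * 4 ^ n"
      using *(2)[of n] step[of n] by blast
    obtain D :: nat where D: "0 < D" "real D \<le> A * B ^ n"
        "\<And>k::int. \<bar>k\<bar> \<le> int n \<Longrightarrow> of_nat D / (z + of_int k) \<in> \<int>" using *(2)[of n] by blast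
    then have "of_nat D * (fact m / pochhammer (z - of_nat m) m) \<in> \<int>" if "m \<le> n" for m
      using step[of m D] that by simp
    then show "\<exists>D::nat. 0 < D \<and> real D \<le> A * B ^ n \<and>
        (\<forall>m\<le>n. of_nat D * (fact m / pochhammer (z - of_nat m) m) \<in> \<int>)"
      using D by blast
  qed
qed

section \<open>Derivatives of Gamma at integer translates\<close>

text \<open>Leibniz's rule for \<open>Gamma' = Gamma \<cdot> Digamma\<close>.\<close>

lemma higher_deriv_Gamma_Suc:
  fixes z :: complex
  assumes z: "z \<notin> \<int>\<^sub>\<le>\<^sub>0"
  shows "(deriv ^^ Suc j) Gamma z =
    (\<Sum>i=0..j. of_nat (j choose i) * (deriv ^^ i) Gamma z * Polygamma (j - i) z)"
proof -
  define S :: "complex set" where "S = - \<int>\<^sub>\<le>\<^sub>0"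
  have S: "open S" "z \<in> S" "S \<inter> \<int>\<^sub>\<le>\<^sub>0 = {}" using z unfolding S_def by (auto intro: open_Compl)
  have hol: "Gamma holomorphic_on S" "Polygamma 0 holomorphic_on S"
    using S by (auto intro!: holomorphic_intros)
  have "(deriv ^^ Suc j) Gamma z = (deriv ^^ j) (deriv Gamma) z"
    by (simp only: funpow_Suc_right o_apply)
  also have "\<dots> = (deriv ^^ j) (\<lambda>w. Gamma w * Polygamma 0 w) z"
  proof (rule higher_deriv_transform_within_open)
    show "deriv Gamma holomorphic_on S" using hol S by (intro holomorphic_deriv)
    show "(\<lambda>w. Gamma w * Polygamma 0 w) holomorphic_on S" using hol by (intro holomorphic_on_mult)
    show "deriv Gamma w = Gamma w * Polygamma 0 w" if "w \<in> S" for w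
      using that unfolding S_def by (intro DERIV_imp_deriv has_field_derivative_Gamma) auto
  qed (use S in auto)
  also have "\<dots> = (\<Sum>i=0..j. of_nat (j choose i) * (deriv ^^ i) Gamma z * (deriv ^^ (j - i)) (Polygamma 0) z)"
    using hol S by (intro higher_deriv_mult)
  also have "\<dots> = (\<Sum>i=0..j. of_nat (j choose i) * (deriv ^^ i) Gamma z * Polygamma (j - i) z)"
    using z by (intro sum.cong refl) (simp add: higher_deriv_Polygamma)
  finally show ?thesis .
qed

lemma rat_nonint_shift:
  assumes "z \<in> \<rat> - \<int>"
  shows "z + of_int k \<in> \<rat> - (\<int> :: complex set)"
proof -
  have "z = (z + of_int k) - of_int k" by simp
  then show ?thesis using assms by (metis DiffD1 DiffD2 DiffI Ints_diff Ints_of_int Rats_add Rats_of_int)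
qed

lemma rat_nonint_not_nonpos_Int: "z \<in> \<rat> - \<int> \<Longrightarrow> z \<notin> \<int>\<^sub>\<le>\<^sub>0"
  using nonpos_Ints_subset_Ints by blast

lemma abs_eq_1_cases:
  fixes e :: int
  assumes "\<bar>e\<bar> = 1"
  obtains "e = 1" | "e = - 1"
  using assms by linarith

text \<open>The value at a translate is \<open>Gamma z\<close> times a rising factorial for \<open>e = 1\<close>, and divided by a
  falling one for \<open>e = -1\<close>. The factor \<open>n!\<close> is removed in the first case and supplied in the second;
  this is what moves the Gevrey order by \<open>e\<close>.\<close>

lemma G_span_Gamma:
  fixes e :: int
  assumes z: "z \<in> \<rat> - \<int>" and e: "\<bar>e\<bar> = 1"
  shows "G_span (\<lambda>n. n) (\<lambda>n. Gamma (z + of_int (e * int n)) / fact n powi e)"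
  using e
proof (cases rule: abs_eq_1_cases)
  case 1
  have "Gamma (z + of_int (e * int n)) / fact n powi e = Gamma z * (pochhammer z n / fact n)" for n
  proof -
    have "Gamma z \<noteq> 0" using z by (simp add: Gamma_eq_zero_iff rat_nonint_not_nonpos_Int)
    then show ?thesis
      using 1 pochhammer_Gamma[OF rat_nonint_not_nonpos_Int[OF z], of n] by simp
  qed
  then show ?thesis using G_span_cmult[OF G_span_base[OF G_bounded_pochhammer[OF z]]] by presburger
next
  case 2
  have "Gamma (z + of_int (e * int n)) / fact n powi e =
      Gamma z * (fact n / pochhammer (z - of_nat n) n)" for n
  proof -
    have z': "z - of_nat n \<in> \<rat> - \<int>" using rat_nonint_shift[OF z, of "- int n"] by simp
    have "Gamma (z - of_nat n) \<noteq> 0" "Gamma z \<noteq> 0" using z z'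
      by (simp_all add: Gamma_eq_zero_iff rat_nonint_not_nonpos_Int)
    moreover have "pochhammer (z - of_nat n) n = Gamma z / Gamma (z - of_nat n)"
      using pochhammer_Gamma[OF rat_nonint_not_nonpos_Int[OF z'], of n] by simp
    ultimately show ?thesis using 2 by (simp add: power_int_minus divide_inverse)
  qed
  then show ?thesis using G_span_cmult[OF G_span_base[OF G_bounded_inverse_pochhammer[OF z]]] by presburger
qed

text \<open>The difference to the value at \<open>z\<close> is a sum of powers of reciprocals \<open>1 / (z \<plusminus> k)\<close> over \<open>k\<close>, with the
  constant \<open>Polygamma i z\<close> as a scalar.\<close>

lemma G_span_Polygamma:
  fixes e :: int
  assumes z: "z \<in> \<rat> - \<int>" and e: "\<bar>e\<bar> = 1"
  shows "G_span (\<lambda>n. n) (\<lambda>n. Polygamma i (z + of_int (e * int n)))"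
proof -
  have sums: "G_span (\<lambda>n. n) (\<lambda>n. \<Sum>k<n. (1 / (x + of_int (e * int k))) ^ Suc i)"
    if "x \<in> \<rat> - \<int>" for x
    using that e by (intro G_span_base G_bounded_partial_sums G_bounded_power G_bounded_reciprocals)
  from e show ?thesis
  proof (cases rule: abs_eq_1_cases)
    case 1
    have "Polygamma i (z + of_int (e * int n)) = Polygamma i z + (-1) ^ i * fact i *
        (\<Sum>k<n. (1 / (z + of_int (e * int k))) ^ Suc i)" for n
    proof -
      have "\<forall>k<n. z \<noteq> - of_nat k" using z by auto
      from Polygamma_plus_of_nat[OF this, of i] show ?thesis using 1 by (simp add: power_divide)
    qed
    then show ?thesis
      using G_span_add[OF G_span_const G_span_cmult[OF sums[OF z]]] by presburger
  next
    case 2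
    \<comment> \<open>Going down from \<open>z\<close> meets the points \<open>z - 1, ..., z - n\<close>, hence the base point \<open>z - 1\<close>.\<close>
    have z1: "z - 1 \<in> \<rat> - \<int>" using rat_nonint_shift[OF z, of "- 1"] by simp
    have "Polygamma i (z + of_int (e * int n)) = Polygamma i z + (- ((-1) ^ i * fact i)) *
        (\<Sum>k<n. (1 / (z - 1 + of_int (e * int k))) ^ Suc i)" for n
    proof -
      have z': "z - of_nat n \<in> \<rat> - \<int>" using rat_nonint_shift[OF z, of "- int n"] by simp
      then have "\<forall>k<n. z - of_nat n \<noteq> - of_nat k" by (metis DiffD2 Ints_minus Ints_of_nat)
      from Polygamma_plus_of_nat[OF this, of i]
      have eq: "Polygamma i z = Polygamma i (z - of_nat n) + (-1) ^ i * fact i *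
          (\<Sum>k<n. 1 / (z - of_nat n + of_nat k) ^ Suc i)" by simp
      have "(\<Sum>k<n. 1 / (z - of_nat n + of_nat k) ^ Suc i) =
          (\<Sum>k<n. (1 / (z - 1 + of_int (e * int k))) ^ Suc i)"
        using 2 by (subst sum.nat_diff_reindex [symmetric])
          (auto intro!: sum.cong simp: power_divide of_nat_diff algebra_simps)
      then show ?thesis unfolding eq using 2 by simp
    qed
    then show ?thesis
      using G_span_add[OF G_span_const G_span_cmult[OF sums[OF z1]]] by presburger
  qed
qed

text \<open>By Leibniz's rule each derivative is a sum of products of lower derivatives, which carry the
  factorial exactly once, with Polygamma values, which carry none.\<close>

lemma G_span_higher_deriv_Gamma:
  fixes e :: int
  assumes z: "z \<in> \<rat> - \<int>" and e: "\<bar>e\<bar> = 1"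
  shows "G_span (\<lambda>n. n) (\<lambda>n. (deriv ^^ j) Gamma (z + of_int (e * int n)) / fact n powi e)"
proof (induction j rule: less_induct)
  case (less j)
  show ?case
  proof (cases j)
    case 0
    then show ?thesis using G_span_Gamma[OF z e] by simp
  next
    case (Suc j')
    have "(deriv ^^ j) Gamma (z + of_int (e * int n)) / fact n powi e =
      (\<Sum>i=0..j'. of_nat (j' choose i) * (((deriv ^^ i) Gamma (z + of_int (e * int n)) / fact n powi e) *
         Polygamma (j' - i) (z + of_int (e * int n))))" for n
      unfolding Suc
        higher_deriv_Gamma_Suc[OF rat_nonint_not_nonpos_Int[OF rat_nonint_shift[OF z]]]
      by (simp add: sum_divide_distrib mult_ac)
    moreover have "G_span (\<lambda>n. n) (\<lambda>n. \<Sum>i=0..j'. of_nat (j' choose i) *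
        (((deriv ^^ i) Gamma (z + of_int (e * int n)) / fact n powi e) *
         Polygamma (j' - i) (z + of_int (e * int n))))"
      using less Suc by (intro G_span_sum G_span_cmult G_span_mult G_span_Polygamma z e) auto
    ultimately show ?thesis by simp
  qed
qed

section \<open>Algebraic numbers in a number field and their denominators\<close>

lemma rat_vector_space: "vector_space (\<lambda>(r::rat) (x::complex). of_rat r * x)"
  by unfold_locales (simp_all add: algebra_simps of_rat_add of_rat_mult)

text \<open>The powers of \<open>x\<close> lie in a space of finite dimension over the rationals, so they are linearly
  dependent or two of them coincide.\<close>

lemma number_field_algebraic:
  assumes K: "number_field K" and x: "x \<in> K"
  shows "algebraic x"
proof -
  interpret Q: vector_space "\<lambda>(r::rat) (x::complex). of_rat r * x" by (rule rat_vector_space)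
  obtain B where B: "finite B" "\<And>y. y \<in> K \<Longrightarrow> \<exists>c :: complex \<Rightarrow> rat. y = (\<Sum>b\<in>B. of_rat (c b) * b)"
    using K unfolding number_field_def by blast
  have pow: "x ^ i \<in> K" for i
    using K x by (induction i) (auto simp: number_field_def)
  define I where "I = {..card B}"
  show ?thesis
  proof (cases "inj_on (\<lambda>i. x ^ i) I")
    case False
    then obtain i j where ij: "i \<noteq> j" "x ^ i = x ^ j" unfolding inj_on_def by blast
    show ?thesis
    proof (rule algebraicI)
      show "coeff (monom 1 i - monom 1 j :: complex poly) k \<in> \<int>" for k by (auto simp: coeff_monom)
      have "coeff (monom 1 i - monom 1 j :: complex poly) i = 1" using ij by (simp add: coeff_monom)
      then show "monom 1 i - monom 1 j \<noteq> (0 :: complex poly)" by (metis coeff_0 zero_neq_one)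
      show "poly (monom 1 i - monom 1 j) x = 0" using ij by (simp add: poly_monom)
    qed
  next
    case True
    define S where "S = (\<lambda>i. x ^ i) ` I"
    have S: "finite S" "card S = card B + 1"
      using True unfolding S_def I_def by (simp_all add: card_image)
    have "S \<subseteq> Q.span B"
    proof
      fix y assume "y \<in> S"
      then obtain c :: "complex \<Rightarrow> rat" where "y = (\<Sum>b\<in>B. of_rat (c b) * b)"
        using pow B(2) unfolding S_def by blast
      then show "y \<in> Q.span B"
        by (simp only:) (intro Q.span_sum Q.span_scale Q.span_base)
    qed
    then have "Q.dependent S" using Q.independent_span_bound[OF B(1), of S] S by auto
    then obtain u :: "complex \<Rightarrow> rat" where u: "\<exists>v\<in>S. u v \<noteq> 0" "(\<Sum>v\<in>S. of_rat (u v) * v) = 0"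
      using Q.dependent_finite[OF S(1)] by blast
    define p :: "complex poly" where "p = (\<Sum>i\<in>I. monom (of_rat (u (x ^ i))) i)"
    have coeff_p: "coeff p k = (if k \<in> I then of_rat (u (x ^ k)) else 0)" for k
      unfolding p_def I_def by (simp add: coeff_sum coeff_monom)
    show ?thesis
    proof (rule algebraicI')
      show "coeff p k \<in> \<rat>" for k unfolding coeff_p by simp
      obtain k where "k \<in> I" "u (x ^ k) \<noteq> 0" using u(1) unfolding S_def by blast
      then have "coeff p k \<noteq> 0" unfolding coeff_p by simp
      then show "p \<noteq> 0" by auto
      have "poly p x = (\<Sum>i\<in>I. of_rat (u (x ^ i)) * x ^ i)"
        unfolding p_def by (simp add: poly_sum poly_monom)
      also have "\<dots> = (\<Sum>v\<in>S. of_rat (u v) * v)"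
        unfolding S_def using True by (simp add: sum.reindex)
      finally show "poly p x = 0" using u(2) by simp
    qed
  qed
qed

lemma number_field_Rats:
  assumes K: "number_field K" and r: "r \<in> \<rat>"
  shows "r \<in> K"
proof -
  have nat: "of_nat n \<in> K" for n using K by (induction n) (auto simp: number_field_def)
  have int: "of_int n \<in> K" for n
    using nat K by (cases n rule: int_cases2) (auto simp: number_field_def)
  obtain a b where "r = of_int a / of_int b" using r by (elim Rats_cases')
  then show ?thesis using int K by (auto simp: number_field_def divide_inverse)
qed

lemma number_field_mult: "number_field K \<Longrightarrow> x \<in> K \<Longrightarrow> y \<in> K \<Longrightarrow> x * y \<in> K"
  by (simp add: number_field_def)

text \<open>If \<open>q\<close> is the denominator of \<open>s\<close>, the \<open>q\<close>-th power of the quotient lies in \<open>K\<close>.\<close>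

lemma algebraic_divide_rat_powr:
  assumes K: "number_field K" and a: "a \<in> K" and m: "m > (0::nat)"
  shows "algebraic (a / of_real (real m powr of_rat s))"
proof -
  obtain u v where uv: "quotient_of s = (u, v)" by (cases "quotient_of s")
  have v: "v > 0" "s = of_int u / of_int v"
    using quotient_of_denom_pos[OF uv] quotient_of_div[OF uv] by auto
  define q where "q = nat v"
  have q: "q > 0" "real q * of_rat s = real_of_int u" using v unfolding q_def
    by (simp_all add: of_rat_divide)
  have "(real m powr of_rat s) ^ q = real m powi u"
    using m q(2) by (subst powr_power) (simp_all add: powr_real_of_int')
  then have "(a / of_real (real m powr of_rat s)) ^ q = a ^ q / of_nat m powi u"
    by (simp add: power_divide of_real_power [symmetric] of_real_power_int [symmetric] del: of_real_power)
  moreover have "a ^ q / of_nat m powi u \<in> K"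
  proof -
    have "a ^ q \<in> K" using a K by (induction q) (auto simp: number_field_def)
    moreover have "inverse (of_nat m powi u) \<in> K"
      by (rule number_field_Rats[OF K]) (simp add: power_int_def)
    ultimately show ?thesis unfolding divide_inverse by (rule number_field_mult[OF K])
  qed
  ultimately have "algebraic ((a / of_real (real m powr of_rat s)) ^ q)"
    using K by (simp add: number_field_algebraic)
  then show ?thesis
    by (rule algebraic_root[where p = "monom 1 q"])
      (use q in \<open>auto simp: poly_monom coeff_monom degree_monom_eq\<close>)
qed

lemma algebraic_intI_sum:
  assumes b: "\<And>i. i < n \<Longrightarrow> b i \<in> \<int>" and y: "y ^ n + (\<Sum>i<n. b i * y ^ i) = 0"
  shows "algebraic_int (y :: complex)"
proof -
  define p where "p = monom 1 n + (\<Sum>i<n. monom (b i) i)"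
  have c: "coeff p k = (if k = n then 1 else if k < n then b k else 0)" for k
    unfolding p_def by (auto simp: coeff_sum coeff_monom)
  have "degree p = n"
  proof (rule antisym)
    show "degree p \<le> n" by (rule degree_le) (simp add: c)
    show "n \<le> degree p" by (rule le_degree) (simp add: c)
  qed
  moreover have "poly p y = 0" using y unfolding p_def by (simp add: poly_sum poly_monom)
  ultimately show ?thesis using b by (intro algebraic_int.intros[of p]) (auto simp: c)
qed

text \<open>Multiply the equation of degree \<open>n\<close> for \<open>x\<close> by \<open>k^n\<close>.\<close>

lemma algebraic_int_of_int_mult:
  assumes "algebraic_int x"
  shows "algebraic_int (of_int k * x :: complex)"
  using assms
proof cases
  case (1 p)
  define n where "n = degree p"
  have "0 = (\<Sum>i\<le>n. coeff p i * x ^ i)" using 1 unfolding n_def poly_altdef by simp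
  also have "\<dots> = x ^ n + (\<Sum>i<n. coeff p i * x ^ i)"
    using 1 unfolding n_def by (simp add: lessThan_Suc_atMost [symmetric] add.commute)
  finally have "of_int k ^ n * (x ^ n + (\<Sum>i<n. coeff p i * x ^ i)) = 0" by simp
  moreover have "of_int k ^ n * (coeff p i * x ^ i) = (of_int k ^ (n - i) * coeff p i) * (of_int k * x) ^ i"
    if "i < n" for i
    using that by (simp add: power_mult_distrib power_add [symmetric] mult_ac)
  ultimately have "(of_int k * x) ^ n + (\<Sum>i<n. (of_int k ^ (n - i) * coeff p i) * (of_int k * x) ^ i) = 0"
    by (simp add: distrib_left sum_distrib_left power_mult_distrib)
  then show ?thesis
    by (rule algebraic_intI_sum[rotated]) (use 1 in auto)
qed

text \<open>Multiplying an integral equation of degree \<open>n\<close> with leading coefficient \<open>c\<close> by \<open>c^(n-1)\<close> makes it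
  monic in \<open>c x\<close>.\<close>

lemma algebraic_denominator:
  assumes "algebraic (x :: complex)"
  obtains D :: nat where "D > 0" "algebraic_int (of_nat D * x)"
proof -
  obtain p where p: "\<And>i. coeff p i \<in> \<int>" "p \<noteq> 0" "poly p x = 0" using assms by (rule algebraicE) (rule that)
  define n where "n = degree p"
  obtain c where c: "coeff p n = of_int c" using p(1)[of n] by (auto elim: Ints_cases)
  have "c \<noteq> 0" using p(2) c unfolding n_def by auto
  have "n > 0"
  proof (rule ccontr)
    assume "\<not> n > 0"
    then have "p = [:of_int c:]" using c unfolding n_def by (metis degree_0_id gr0I)
    then show False using p \<open>c \<noteq> 0\<close> by simp
  qed
  then obtain m where m: "n = Suc m" by (cases n) auto
  have "0 = (\<Sum>i\<le>n. coeff p i * x ^ i)" using p unfolding n_def poly_altdef by simp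
  also have "\<dots> = of_int c * x ^ n + (\<Sum>i<n. coeff p i * x ^ i)"
    using c by (simp add: lessThan_Suc_atMost [symmetric] add.commute)
  finally have zero: "of_int c * x ^ n + (\<Sum>i<n. coeff p i * x ^ i) = 0" by simp
  have "(\<Sum>i<n. (of_int c ^ (m - i) * coeff p i) * (of_int c * x) ^ i) =
      (\<Sum>i<n. of_int c ^ m * (coeff p i * x ^ i))"
  proof (rule sum.cong)
    fix i assume "i \<in> {..<n}"
    then have "(of_int c :: complex) ^ m = of_int c ^ (m - i) * of_int c ^ i"
      using m by (simp add: power_add [symmetric])
    then show "(of_int c ^ (m - i) * coeff p i) * (of_int c * x) ^ i = of_int c ^ m * (coeff p i * x ^ i)"
      by (simp add: power_mult_distrib)
  qed simp
  moreover have "(of_int c * x) ^ n = of_int c ^ m * (of_int c * x ^ n)"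
    unfolding m by (simp add: power_mult_distrib)
  ultimately have "(of_int c * x) ^ n + (\<Sum>i<n. (of_int c ^ (m - i) * coeff p i) * (of_int c * x) ^ i) =
      of_int c ^ m * (of_int c * x ^ n + (\<Sum>i<n. coeff p i * x ^ i))"
    by (simp only: distrib_left sum_distrib_left)
  also have "\<dots> = 0" unfolding zero by simp
  finally have "(of_int c * x) ^ n + (\<Sum>i<n. (of_int c ^ (m - i) * coeff p i) * (of_int c * x) ^ i) = 0" .
  then have "algebraic_int (of_int c * x)"
    by (rule algebraic_intI_sum[rotated]) (use p in auto)
  then have "algebraic_int (of_int (sgn c) * (of_int c * x))" by (rule algebraic_int_of_int_mult)
  moreover have "of_int (sgn c) * (of_int c * x) = of_nat (nat \<bar>c\<bar>) * x"
  proof -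
    have "sgn c * c = \<bar>c\<bar>" by (cases "c < 0") (auto simp: sgn_if)
    also have "\<dots> = int (nat \<bar>c\<bar>)" by simp
    finally have "of_int (sgn c * c) * x = of_int (int (nat \<bar>c\<bar>)) * x" by (simp only:)
    then show ?thesis by (simp only: of_int_mult of_int_of_nat_eq mult.assoc)
  qed
  ultimately have "algebraic_int (of_nat (nat \<bar>c\<bar>) * x)" by (simp only:)
  moreover have "nat \<bar>c\<bar> > 0" using \<open>c \<noteq> 0\<close> by simp
  ultimately show ?thesis by (rule that[rotated])
qed

lemma common_denom_le:
  assumes "0 < D" "\<And>a. a \<in> A \<Longrightarrow> algebraic_int (of_nat D * a)"
  shows "common_denom A \<le> D"
  unfolding common_denom_def by (rule Least_le) (use assms in simp)

text \<open>The product of individual denominators witnesses that the least common denominator exists.\<close>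

lemma common_denom_works:
  assumes A: "finite A" "\<And>a. a \<in> A \<Longrightarrow> algebraic a"
  shows "0 < common_denom A" "\<And>a. a \<in> A \<Longrightarrow> algebraic_int (of_nat (common_denom A) * a)"
proof -
  obtain d :: "complex \<Rightarrow> nat" where d: "\<And>a. a \<in> A \<Longrightarrow> d a > 0 \<and> algebraic_int (of_nat (d a) * a)"
  proof -
    have "\<forall>a\<in>A. \<exists>D::nat. D > 0 \<and> algebraic_int (of_nat D * a)"
    proof
      fix a assume "a \<in> A"
      then have "algebraic a" by (rule A(2))
      then obtain D :: nat where "D > 0" "algebraic_int (of_nat D * a)"
        by (rule algebraic_denominator)
      then show "\<exists>D::nat. D > 0 \<and> algebraic_int (of_nat D * a)" by blast
    qed
    then obtain d :: "complex \<Rightarrow> nat" where "\<forall>a\<in>A. d a > 0 \<and> algebraic_int (of_nat (d a) * a)"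
      by (rule bchoice[THEN exE])
    then show ?thesis by (intro that) (rule bspec)
  qed
  have "algebraic_int (of_nat (\<Prod>a\<in>A. d a) * a)" if "a \<in> A" for a
  proof -
    have "(of_nat (\<Prod>a\<in>A. d a) :: complex) * a = of_int (int (\<Prod>b\<in>A - {a}. d b)) * (of_nat (d a) * a)"
      using that A(1) by (subst prod.remove[of A a]) (auto simp: mult_ac)
    also have "algebraic_int \<dots>" using d that by (intro algebraic_int_of_int_mult) auto
    finally show ?thesis .
  qed
  moreover have "0 < (\<Prod>a\<in>A. d a)" using d by (intro prod_pos) auto
  ultimately have "\<exists>D. 0 < D \<and> (\<forall>a\<in>A. algebraic_int (of_nat D * a))" by blast
  then have "0 < common_denom A \<and> (\<forall>a\<in>A. algebraic_int (of_nat (common_denom A) * a))"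
    unfolding common_denom_def by (rule LeastI_ex)
  then show "0 < common_denom A" "\<And>a. a \<in> A \<Longrightarrow> algebraic_int (of_nat (common_denom A) * a)" by auto
qed

lemma finite_mdeg_le: "finite {\<alpha> :: nat ^ 'd::finite. mdeg \<alpha> \<le> n}"
proof (rule finite_subset)
  show "{\<alpha> :: nat ^ 'd. mdeg \<alpha> \<le> n} \<subseteq> vec_lambda ` (PiE UNIV (\<lambda>_. {..n}))"
  proof
    fix \<alpha> :: "nat ^ 'd" assume "\<alpha> \<in> {\<alpha>. mdeg \<alpha> \<le> n}"
    then have "\<alpha> $ i \<le> n" for i
      using member_le_sum[of i UNIV "\<lambda>i. \<alpha> $ i"] unfolding mdeg_def by simp
    then have "vec_nth \<alpha> \<in> PiE UNIV (\<lambda>_. {..n})" by (auto simp: PiE_def)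
    then show "\<alpha> \<in> vec_lambda ` (PiE UNIV (\<lambda>_. {..n}))" by (metis image_eqI vec_nth_inverse)
  qed
  show "finite (vec_lambda ` (PiE UNIV (\<lambda>_. {..n})) :: (nat ^ 'd) set)"
    by (intro finite_imageI finite_PiE) auto
qed

section \<open>Conjugates of rational multiples\<close>

lemma map_poly_of_rat_scale:
  "map_poly of_rat (pcompose p [:0, \<rho>:]) = pcompose (map_poly of_rat p) [:0, of_rat \<rho> :: complex:]"
  by (rule poly_eqI) (simp add: coeff_map_poly coeff_pcompose_linear of_rat_mult of_rat_power)

lemma is_unit_pcompose:
  fixes p q :: "'a::field poly"
  assumes "is_unit p"
  shows "is_unit (pcompose p q)"
proof -
  obtain p' where "1 = p * p'" using assms by (elim dvdE)
  then have "1 = pcompose p q * pcompose p' q" by (metis pcompose_1 pcompose_mult)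
  then show ?thesis by (rule dvdI)
qed

text \<open>The substitution \<open>X \<mapsto> \<rho> X\<close> is an automorphism of the polynomial ring.\<close>

lemma irreducible_pcompose_scale:
  fixes p :: "'a::field poly"
  assumes p: "irreducible p" and \<rho>: "\<rho> \<noteq> 0"
  shows "irreducible (pcompose p [:0, \<rho>:])"
proof -
  have inv: "pcompose (pcompose u [:0, \<rho>:]) [:0, inverse \<rho>:] = u"
    "pcompose (pcompose u [:0, inverse \<rho>:]) [:0, \<rho>:] = u" for u
    using \<rho> by (simp_all add: pcompose_assoc [symmetric] pcompose_pCons)
  show ?thesis
  proof (rule irreducibleI)
    show "pcompose p [:0, \<rho>:] \<noteq> 0" using p inv(1)[of p] by auto
    show "\<not> is_unit (pcompose p [:0, \<rho>:])"
      using p is_unit_pcompose[of "pcompose p [:0, \<rho>:]" "[:0, inverse \<rho>:]"] inv(1)[of p]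
      by (auto simp: irreducible_def)
    fix a b assume "pcompose p [:0, \<rho>:] = a * b"
    then have "p = pcompose a [:0, inverse \<rho>:] * pcompose b [:0, inverse \<rho>:]"
      by (metis inv(1) pcompose_mult)
    then have "is_unit (pcompose a [:0, inverse \<rho>:]) \<or> is_unit (pcompose b [:0, inverse \<rho>:])"
      using p by (auto dest: irreducibleD)
    then show "is_unit a \<or> is_unit b"
      using is_unit_pcompose[of _ "[:0, \<rho>:]"] inv(2) by metis
  qed
qed

lemma conjugate_over_Q_rat_mult:
  assumes c: "conjugate_over_Q (z * r) w" and r: "r \<in> \<rat>" "r \<noteq> 0"
  shows "conjugate_over_Q z (w / r)"
proof -
  obtain p :: "rat poly" where p: "irreducible p"
      "poly (map_poly of_rat p) (z * r) = 0" "poly (map_poly of_rat p) w = 0"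
    using c unfolding conjugate_over_Q_def by blast
  obtain \<rho> where \<rho>: "r = of_rat \<rho>" using r(1) by (elim Rats_cases)
  show ?thesis
    unfolding conjugate_over_Q_def
  proof (intro exI conjI)
    show "irreducible (pcompose p [:0, \<rho>:])" using p(1) \<rho> r(2) by (intro irreducible_pcompose_scale) auto
    show "poly (map_poly of_rat (pcompose p [:0, \<rho>:])) z = 0"
      unfolding map_poly_of_rat_scale poly_pcompose using p(2) \<rho> by (simp add: mult.commute)
    show "poly (map_poly of_rat (pcompose p [:0, \<rho>:])) (w / r) = 0"
      unfolding map_poly_of_rat_scale poly_pcompose using p(3) \<rho> r(2) by simp
  qed
qed

lemma conjugate_over_Q_zero:
  assumes "conjugate_over_Q 0 w"
  shows "w = 0"
proof -
  obtain p :: "rat poly" where p: "irreducible p"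
      "poly (map_poly of_rat p) (0::complex) = 0" "poly (map_poly of_rat p) w = 0"
    using assms unfolding conjugate_over_Q_def by blast
  have "poly p 0 = 0" using p(2) by (simp add: poly_0_coeff_0 coeff_map_poly)
  then have "[:0, 1:] dvd p" by (simp add: poly_eq_0_iff_dvd)
  then obtain q where q: "p = [:0, 1:] * q" by (elim dvdE)
  have "\<not> is_unit [:0, 1 :: rat:]" by (simp add: is_unit_iff_degree)
  then have "is_unit q" using irreducibleD[OF p(1) q] by blast
  then obtain a where a: "q = [:a:]" by (auto simp: is_unit_poly_iff)
  have "a \<noteq> 0" using p(1) unfolding q a by auto
  have "map_poly of_rat p = [:0, of_rat a :: complex:]" unfolding q a by (simp add: map_poly_pCons)
  then show ?thesis using p(3) \<open>a \<noteq> 0\<close> by simp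
qed

section \<open>Multiplying an arithmetic Gevrey series coefficientwise\<close>

lemma mfact_pos: "mfact \<alpha> > 0"
  unfolding mfact_def by (intro prod_pos) auto

lemma G_bounded_imp_Rats:
  assumes "G_bounded w r"
  shows "r x \<in> \<rat>"
proof -
  obtain D :: nat where D: "0 < D" "of_nat D * r x \<in> \<int>" using assms unfolding G_bounded_def by blast
  obtain k where "of_nat D * r x = of_int k" using D(2) by (elim Ints_cases)
  then have "r x = of_int k / of_nat D" using D(1) by (simp add: field_simps)
  then show ?thesis by simp
qed

text \<open>A nonzero rational factor scales the conjugates by the same factor.\<close>

lemma cond_A1_mult:
  assumes a: "cond_A1 a" and r: "G_bounded mdeg r"
  shows "cond_A1 (\<lambda>\<alpha>. a \<alpha> * r \<alpha>)"
proof -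
  obtain C where C: "0 < C" "\<And>\<alpha> w. conjugate_over_Q (a \<alpha>) w \<Longrightarrow> cmod w \<le> C ^ (mdeg \<alpha> + 1)"
    using a unfolding cond_A1_def by blast
  obtain B where B: "1 \<le> B" "\<And>\<alpha>. cmod (r \<alpha>) \<le> B ^ (mdeg \<alpha> + 1)"
    using r unfolding G_bounded_def by blast
  have "cmod w \<le> (C * B) ^ (mdeg \<alpha> + 1)" if w: "conjugate_over_Q (a \<alpha> * r \<alpha>) w" for \<alpha> w
  proof (cases "r \<alpha> = 0")
    case True
    then have "w = 0" using w conjugate_over_Q_zero by simp
    then show ?thesis using B(1) C(1) by simp
  next
    case False
    then have "cmod (w / r \<alpha>) \<le> C ^ (mdeg \<alpha> + 1)"
      using w by (intro C(2) conjugate_over_Q_rat_mult G_bounded_imp_Rats[OF r])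
    then have "cmod (w / r \<alpha>) * cmod (r \<alpha>) \<le> C ^ (mdeg \<alpha> + 1) * B ^ (mdeg \<alpha> + 1)"
      using B(2) C(1) by (intro mult_mono) auto
    then show ?thesis using False by (simp add: norm_divide power_mult_distrib mult_ac)
  qed
  then show ?thesis unfolding cond_A1_def using B(1) C(1) by (intro exI[of _ "C * B"]) auto
qed

lemma cond_A2_mult:
  fixes a :: "nat ^ 'd::finite \<Rightarrow> complex"
  assumes a: "cond_A2 a" "\<And>\<alpha>. algebraic (a \<alpha>)" and r: "G_bounded mdeg r"
  shows "cond_A2 (\<lambda>\<alpha>. a \<alpha> * r \<alpha>)"
proof -
  define A where "A n = {a \<alpha> |\<alpha>. mdeg \<alpha> \<le> n}" for n
  obtain C where C: "0 < C" "\<And>n. real (common_denom (A n)) \<le> C ^ (n + 1)"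
    using a(1) unfolding cond_A2_def A_def by blast
  obtain B D where B: "1 \<le> B" "\<And>\<alpha>. cmod (r \<alpha>) \<le> B ^ (mdeg \<alpha> + 1)" "\<And>n. 0 < D n"
    "\<And>n. real (D n) \<le> B ^ (n + 1)" "\<And>n \<alpha>. mdeg \<alpha> \<le> n \<Longrightarrow> of_nat (D n) * r \<alpha> \<in> \<int>"
    using r by (rule G_boundedE) (rule that)
  have A: "finite (A n)" "\<And>z. z \<in> A n \<Longrightarrow> algebraic z" for n
    using finite_mdeg_le[where 'd='d] a(2) unfolding A_def by auto
  have "real (common_denom {a \<alpha> * r \<alpha> |\<alpha>. mdeg \<alpha> \<le> n}) \<le> (C * B) ^ (n + 1)" for n
  proof -
    have "common_denom {a \<alpha> * r \<alpha> |\<alpha>. mdeg \<alpha> \<le> n} \<le> D n * common_denom (A n)"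
    proof (rule common_denom_le)
      show "0 < D n * common_denom (A n)" using B(3) common_denom_works(1)[OF A] by simp
      fix z assume "z \<in> {a \<alpha> * r \<alpha> |\<alpha>. mdeg \<alpha> \<le> n}"
      then obtain \<alpha> where \<alpha>: "mdeg \<alpha> \<le> n" "z = a \<alpha> * r \<alpha>" by blast
      obtain k where k: "of_nat (D n) * r \<alpha> = of_int k" using B(5)[OF \<alpha>(1)] by (elim Ints_cases)
      have "algebraic_int (of_nat (common_denom (A n)) * a \<alpha>)"
        using \<alpha>(1) by (intro common_denom_works(2)[OF A]) (auto simp: A_def)
      then have "algebraic_int (of_int k * (of_nat (common_denom (A n)) * a \<alpha>))"
        by (rule algebraic_int_of_int_mult)
      then show "algebraic_int (of_nat (D n * common_denom (A n)) * z)"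
        unfolding \<alpha>(2) k [symmetric] by (simp add: mult_ac)
    qed
    then have "real (common_denom {a \<alpha> * r \<alpha> |\<alpha>. mdeg \<alpha> \<le> n}) \<le> real (D n * common_denom (A n))"
      by (simp only: of_nat_le_iff)
    also have "\<dots> = real (D n) * real (common_denom (A n))" by simp
    also have "\<dots> \<le> B ^ (n + 1) * C ^ (n + 1)" using B C by (intro mult_mono) auto
    finally show ?thesis by (simp add: power_mult_distrib mult_ac)
  qed
  then show ?thesis unfolding cond_A2_def using B(1) C(1) by (intro exI[of _ "C * B"]) auto
qed

text \<open>The power of \<open>\<alpha>!\<close> cancels against the change of the Gevrey order, so the normalised coefficients
  are only multiplied by the family \<open>r\<close>.\<close>

lemma gevrey_coeffs_mult:
  fixes a :: "nat ^ 'd::finite \<Rightarrow> complex" and e :: int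
  assumes K: "number_field K" and a: "a \<in> gevrey_coeffs K s" and r: "G_bounded mdeg r"
  shows "(\<lambda>\<alpha>. a \<alpha> * (of_nat (mfact \<alpha>) powi e * r \<alpha>)) \<in> gevrey_coeffs K (s + of_int e)"
proof -
  define b where "b = (\<lambda>\<alpha>. a \<alpha> / of_real (real (mfact \<alpha>) powr of_rat s))"
  have aK: "a \<alpha> \<in> K" for \<alpha> using a unfolding gevrey_coeffs_def by blast
  have eq: "a \<alpha> * (of_nat (mfact \<alpha>) powi e * r \<alpha>) / of_real (real (mfact \<alpha>) powr of_rat (s + of_int e)) =
      b \<alpha> * r \<alpha>" for \<alpha>
  proof -
    have "real (mfact \<alpha>) powr of_rat (s + of_int e) =
        real (mfact \<alpha>) powr of_rat s * real (mfact \<alpha>) powi e"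
      using mfact_pos[of \<alpha>] by (simp add: of_rat_add powr_add powr_real_of_int')
    then show ?thesis
      using mfact_pos[of \<alpha>] unfolding b_def by (simp add: of_real_power_int)
  qed
  have "algebraic (b \<alpha>)" for \<alpha>
    unfolding b_def using K aK mfact_pos by (intro algebraic_divide_rat_powr)
  moreover have "cond_A1 b" "cond_A2 b" using a unfolding gevrey_coeffs_def b_def by auto
  ultimately have "cond_A1 (\<lambda>\<alpha>. b \<alpha> * r \<alpha>)" "cond_A2 (\<lambda>\<alpha>. b \<alpha> * r \<alpha>)"
    using r by (auto intro: cond_A1_mult cond_A2_mult)
  moreover have "a \<alpha> * (of_nat (mfact \<alpha>) powi e * r \<alpha>) \<in> K" for \<alpha>
  proof -
    have "of_nat (mfact \<alpha>) powi e \<in> (\<rat> :: complex set)"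
      by (auto simp: power_int_def)
    then have "of_nat (mfact \<alpha>) powi e * r \<alpha> \<in> \<rat>" using G_bounded_imp_Rats[OF r] by (rule Rats_mult)
    then have "of_nat (mfact \<alpha>) powi e * r \<alpha> \<in> K" by (rule number_field_Rats[OF K])
    with aK show ?thesis by (rule number_field_mult[OF K])
  qed
  ultimately show ?thesis unfolding gevrey_coeffs_def mem_Collect_eq eq by (intro conjI allI)
qed

section \<open>Coefficients of expressions and of their Laplace transforms\<close>

text \<open>The exponent change of the Laplace transform: \<open>x^\<gamma>\<close> becomes \<open>x^(-\<gamma>-1)\<close> in every variable.\<close>

definition reflect :: "complex ^ 'd::finite \<Rightarrow> complex ^ 'd" where
  "reflect \<gamma> = (\<chi> i. - \<gamma> $ i - 1)"

lemma reflect_reflect [simp]: "reflect (reflect \<gamma>) = \<gamma>"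
  by (simp add: reflect_def vec_eq_iff)

lemma reflect_eq_iff: "reflect \<gamma> = \<delta> \<longleftrightarrow> \<gamma> = reflect \<delta>"
  by auto

lemma shift_inject [simp]: "shift \<gamma> \<beta> = shift \<gamma> \<beta>' \<longleftrightarrow> \<beta> = \<beta>'"
  by (simp add: shift_def vec_eq_iff)

lemma reflect_shift: "reflect (shift \<gamma> \<beta>) = shift (reflect \<gamma>) (- \<beta>)"
  by (simp add: reflect_def shift_def vec_eq_iff)

lemma nonint_rat_vecs_iff: "\<gamma> \<in> nonint_rat_vecs \<longleftrightarrow> (\<forall>i. \<gamma> $ i \<in> \<rat> - \<int>)"
  by (simp add: nonint_rat_vecs_def)

lemma shift_nonint_rat_vecs: "\<gamma> \<in> nonint_rat_vecs \<Longrightarrow> shift \<gamma> \<beta> \<in> nonint_rat_vecs"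
  using rat_nonint_shift by (auto simp: nonint_rat_vecs_iff shift_def)

lemma reflect_nonint_rat_vecs: "\<gamma> \<in> nonint_rat_vecs \<Longrightarrow> reflect \<gamma> \<in> nonint_rat_vecs"
proof -
  assume \<gamma>: "\<gamma> \<in> nonint_rat_vecs"
  have "- z - 1 \<in> \<rat> - \<int>" if z: "z \<in> \<rat> - \<int>" for z :: complex
  proof -
    have "- z - 1 \<notin> \<int>"
    proof
      assume "- z - 1 \<in> \<int>"
      then have "- (- z - 1) \<in> \<int>" by (rule Ints_minus)
      then show False using rat_nonint_shift[OF z, of 1] by (simp add: add.commute)
    qed
    then show ?thesis using z by simp
  qed
  then show ?thesis using \<gamma> by (simp add: nonint_rat_vecs_iff reflect_def)
qed

lemma Sum_any_eq_single:
  assumes "\<And>x. x \<noteq> a \<Longrightarrow> f x = 0"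
  shows "Sum_any f = f a"
  using assms by (subst Sum_any.expand_superset[of "{a}"]) auto

lemma h_apply: "h \<gamma> k p = (if p = (\<gamma>, k) then 1 else 0)"
proof -
  obtain \<delta> m where p: "p = (\<delta>, m)" by (cases p)
  show ?thesis
  proof (cases "p = (\<gamma>, k)")
    case True
    then show ?thesis by (simp add: h_def prod_vars_def h1_def)
  next
    case False
    then obtain i where "\<delta> $ i \<noteq> \<gamma> $ i \<or> m $ i \<noteq> k $ i" unfolding p by (auto simp: vec_eq_iff)
    then have "h1 (\<gamma> $ i) (k $ i) (\<delta> $ i, m $ i) = 0" unfolding h1_def by auto
    then show ?thesis using False unfolding p h_def prod_vars_def by (auto intro: prod_zero)
  qed
qed

lemma times_h_shift: "times_h g \<gamma> k (shift \<gamma> \<beta>, m) = (if m = k then g \<beta> else 0)"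
  unfolding times_h_def by (subst Sum_any_eq_single[of \<beta>]) (auto simp: h_apply)

lemma times_h_outside: "\<delta> \<notin> range (shift \<gamma>) \<Longrightarrow> times_h g \<gamma> k (\<delta>, m) = 0"
  unfolding times_h_def
  \<comment> \<open>All summands vanish, so any index may serve as the exceptional one.\<close>
  by (rule Sum_any_eq_single[THEN trans, of undefined]) (auto simp: h_apply)

lemma times_h_eqI:
  fixes F :: "'d::finite expr"
  assumes "\<And>\<beta> m. F (shift \<gamma> \<beta>, m) = (if m = k then g \<beta> else 0)"
    and "\<And>\<delta> m. \<delta> \<notin> range (shift \<gamma>) \<Longrightarrow> F (\<delta>, m) = 0"
  shows "F = times_h g \<gamma> k"
proof
  fix p :: "(complex ^ 'd) \<times> (nat ^ 'd)"
  obtain \<delta> m where p: "p = (\<delta>, m)" by (cases p)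
  show "F p = times_h g \<gamma> k p"
  proof (cases "\<delta> \<in> range (shift \<gamma>)")
    case True
    then obtain \<beta> where "\<delta> = shift \<gamma> \<beta>" by blast
    then show ?thesis unfolding p by (simp only: assms(1) times_h_shift)
  next
    case False
    show ?thesis unfolding p assms(2)[OF False] times_h_outside[OF False] ..
  qed
qed

lemma times_h_add: "times_h (\<lambda>\<beta>. g \<beta> + g' \<beta>) \<gamma> k = times_h g \<gamma> k + times_h g' \<gamma> k"
  by (rule times_h_eqI[symmetric]) (simp_all add: times_h_shift times_h_outside)

lemma times_h_cmult: "times_h (\<lambda>\<beta>. c * g \<beta>) \<gamma> k = scale c (times_h g \<gamma> k)"
  by (rule times_h_eqI[symmetric]) (simp_all add: times_h_shift times_h_outside scale_def)

lemma sum_apply_fun: "(\<Sum>i\<in>I. f i) x = (\<Sum>i\<in>I. f i x :: 'b::comm_monoid_add)"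
  by (induction I rule: infinite_finite_induct) auto

text \<open>The coefficient of \<open>x^(-\<gamma>-1) (log x)^m\<close> in the transform of \<open>x^\<gamma> (log x)^k\<close>.\<close>

definition laplace_coeff :: "complex ^ 'd::finite \<Rightarrow> nat ^ 'd \<Rightarrow> nat ^ 'd \<Rightarrow> complex" where
  "laplace_coeff \<gamma> k m = (\<Prod>i\<in>UNIV. if m $ i \<le> k $ i
     then of_nat (k $ i choose m $ i) * (deriv ^^ (k $ i - m $ i)) Gamma (\<gamma> $ i + 1) * (- 1) ^ (m $ i)
     else 0)"

lemma laplace1_apply:
  "laplace1 \<gamma> k (\<delta>, m) = (if \<delta> = - \<gamma> - 1 \<and> m \<le> k
     then of_nat (k choose m) * (deriv ^^ (k - m)) Gamma (\<gamma> + 1) * (- 1) ^ m else 0)"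
proof -
  have "laplace1 \<gamma> k (\<delta>, m) = (\<Sum>j=0..k. if j = k - m \<and> \<delta> = - \<gamma> - 1 \<and> m \<le> k
      then of_nat (k choose m) * (deriv ^^ (k - m)) Gamma (\<gamma> + 1) * (- 1) ^ m else 0)"
    unfolding laplace1_def sum_apply_fun
  proof (rule sum.cong)
    fix j assume "j \<in> {0..k}"
    then have iff: "(\<delta>, m) = (- \<gamma> - 1, k - j) \<longleftrightarrow> j = k - m \<and> \<delta> = - \<gamma> - 1 \<and> m \<le> k" by auto
    show "scale (of_nat (k choose j) * (deriv ^^ j) Gamma (\<gamma> + 1) * (- 1) ^ (k - j))
        (h1 (- \<gamma> - 1) (k - j)) (\<delta>, m) =
      (if j = k - m \<and> \<delta> = - \<gamma> - 1 \<and> m \<le> k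
      then of_nat (k choose m) * (deriv ^^ (k - m)) Gamma (\<gamma> + 1) * (- 1) ^ m else 0)"
    proof (cases "j = k - m \<and> \<delta> = - \<gamma> - 1 \<and> m \<le> k")
      case True
      then have "k - j = m" "(k choose j) = (k choose m)" using binomial_symmetric[of m k] by auto
      then show ?thesis using True unfolding scale_def h1_def by simp
    next
      case False
      then have "h1 (- \<gamma> - 1) (k - j) (\<delta>, m) = 0" unfolding h1_def by (simp only: iff if_False)
      then show ?thesis using False unfolding scale_def by (simp only: mult_zero_right if_False)
    qed
  qed simp
  then show ?thesis by (auto simp: sum.delta')
qed

lemma prod_vars_laplace1:
  "prod_vars (\<lambda>i. laplace1 (\<gamma> $ i) (k $ i)) (\<delta>, m) = (if \<delta> = reflect \<gamma> then laplace_coeff \<gamma> k m else 0)"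
proof (cases "\<delta> = reflect \<gamma>")
  case True
  then show ?thesis by (auto simp: prod_vars_def laplace1_apply laplace_coeff_def reflect_def intro!: prod.cong)
next
  case False
  then obtain i where "\<delta> $ i \<noteq> - \<gamma> $ i - 1" by (auto simp: reflect_def vec_eq_iff)
  then have "laplace1 (\<gamma> $ i) (k $ i) (\<delta> $ i, m $ i) = 0" by (simp add: laplace1_apply)
  then show ?thesis using False unfolding prod_vars_def by (auto intro: prod_zero)
qed

lemma laplace_times_h_reflect_shift:
  "laplace_times_h g \<gamma> k (reflect (shift \<gamma> \<beta>), m) = g \<beta> * laplace_coeff (shift \<gamma> \<beta>) k m"
  unfolding laplace_times_h_def
  by (subst Sum_any_eq_single[of \<beta>]) (auto simp: prod_vars_laplace1 reflect_eq_iff)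

lemma laplace_times_h_outside:
  "reflect \<delta> \<notin> range (shift \<gamma>) \<Longrightarrow> laplace_times_h g \<gamma> k (\<delta>, m) = 0"
  unfolding laplace_times_h_def
  \<comment> \<open>All summands vanish, so any index may serve as the exceptional one.\<close>
  by (rule Sum_any_eq_single[THEN trans, of undefined]) (auto simp: prod_vars_laplace1 reflect_eq_iff)

section \<open>The Laplace transform as a linear injective map\<close>

text \<open>This form of the transform reads off the coefficients of \<open>F\<close> and does not mention a way of
  writing \<open>F\<close> as a finite sum, so it shows that the induced map is well defined.\<close>

definition laplace_map :: "'d::finite expr \<Rightarrow> 'd expr" where
  "laplace_map F = (\<lambda>(\<delta>, m). Sum_any (\<lambda>k. F (reflect \<delta>, k) * laplace_coeff (reflect \<delta>) k m))"

lemma laplace_map_times_h: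
  fixes g :: "'d::finite series"
  shows "laplace_map (times_h g \<gamma> k) = laplace_times_h g \<gamma> k"
proof
  fix p :: "(complex ^ 'd) \<times> (nat ^ 'd)"
  obtain \<delta> m where p: "p = (\<delta>, m)" by (cases p)
  show "laplace_map (times_h g \<gamma> k) p = laplace_times_h g \<gamma> k p"
  proof (cases "reflect \<delta> \<in> range (shift \<gamma>)")
    case True
    then obtain \<beta> where \<beta>: "\<delta> = reflect (shift \<gamma> \<beta>)" by (auto simp: reflect_eq_iff)
    show ?thesis unfolding p \<beta> laplace_map_def laplace_times_h_reflect_shift
      by (simp add: Sum_any_eq_single[of k] times_h_shift)
  next
    case False
    then show ?thesis unfolding p laplace_map_def by (simp add: laplace_times_h_outside times_h_outside)
  qed
qed

text \<open>A linear space that contains all the spaces \<open>NGA S\<close>, on which the sums in \<open>laplace_map\<close> are finite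
  and no pole of Gamma is met.\<close>

definition log_finite :: "'d::finite expr set" where
  "log_finite = {F. (\<forall>\<gamma>. finite {k. F (\<gamma>, k) \<noteq> 0}) \<and> (\<forall>\<gamma> k. F (\<gamma>, k) \<noteq> 0 \<longrightarrow> \<gamma> \<in> nonint_rat_vecs)}"

lemma log_finite_zero: "0 \<in> log_finite"
  by (simp add: log_finite_def)

lemma log_finite_add:
  assumes "F \<in> log_finite" "G \<in> log_finite"
  shows "F + G \<in> log_finite"
proof -
  have "{k. (F + G) (\<gamma>, k) \<noteq> 0} \<subseteq> {k. F (\<gamma>, k) \<noteq> 0} \<union> {k. G (\<gamma>, k) \<noteq> 0}" for \<gamma> by auto
  then have "finite {k. (F + G) (\<gamma>, k) \<noteq> 0}" for \<gamma>
    by (rule finite_subset) (use assms in \<open>simp add: log_finite_def\<close>)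
  moreover have "\<gamma> \<in> nonint_rat_vecs" if "(F + G) (\<gamma>, k) \<noteq> 0" for \<gamma> k
  proof -
    have "F (\<gamma>, k) \<noteq> 0 \<or> G (\<gamma>, k) \<noteq> 0" using that by auto
    then show ?thesis using assms unfolding log_finite_def by blast
  qed
  ultimately show ?thesis unfolding log_finite_def by blast
qed

lemma log_finite_scale:
  assumes "F \<in> log_finite"
  shows "scale c F \<in> log_finite"
proof -
  have "{k. scale c F (\<gamma>, k) \<noteq> 0} \<subseteq> {k. F (\<gamma>, k) \<noteq> 0}" for \<gamma> by (auto simp: scale_def)
  then show ?thesis using assms unfolding log_finite_def
    by (auto intro: finite_subset simp: scale_def)
qed

lemma log_finite_sum: "(\<And>i. i \<in> I \<Longrightarrow> F i \<in> log_finite) \<Longrightarrow> (\<Sum>i\<in>I. F i) \<in> log_finite"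
  by (induction I rule: infinite_finite_induct) (auto intro: log_finite_zero log_finite_add)

lemma times_h_log_finite:
  assumes \<gamma>: "\<gamma> \<in> nonint_rat_vecs"
  shows "times_h g \<gamma> k \<in> log_finite"
proof -
  have nz: "m = k \<and> \<delta> \<in> range (shift \<gamma>)" if "times_h g \<gamma> k (\<delta>, m) \<noteq> 0" for \<delta> m
  proof
    show range: "\<delta> \<in> range (shift \<gamma>)" using that times_h_outside by blast
    then obtain \<beta> where "\<delta> = shift \<gamma> \<beta>" by blast
    then show "m = k" using that by (simp add: times_h_shift split: if_splits)
  qed
  have "finite {m. times_h g \<gamma> k (\<delta>, m) \<noteq> 0}" for \<delta>
    by (rule finite_subset[of _ "{k}"]) (use nz in auto)
  moreover have "\<delta> \<in> nonint_rat_vecs" if "times_h g \<gamma> k (\<delta>, m) \<noteq> 0" for \<delta> m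
    using nz[OF that] shift_nonint_rat_vecs[OF \<gamma>] by auto
  ultimately show ?thesis unfolding log_finite_def by blast
qed

lemma NGA_subset_log_finite: "NGA S \<subseteq> log_finite"
  unfolding NGA_def by (auto intro!: log_finite_sum times_h_log_finite)

lemma laplace_map_add:
  fixes F G :: "'d::finite expr"
  assumes "F \<in> log_finite" "G \<in> log_finite"
  shows "laplace_map (F + G) = laplace_map F + laplace_map G"
proof
  fix p :: "(complex ^ 'd) \<times> (nat ^ 'd)"
  obtain \<delta> m where p: "p = (\<delta>, m)" by (cases p)
  have "finite {k. H (reflect \<delta>, k) * laplace_coeff (reflect \<delta>) k m \<noteq> 0}" if "H \<in> log_finite" for H
    by (rule finite_subset[of _ "{k. H (reflect \<delta>, k) \<noteq> 0}"]) (use that in \<open>auto simp: log_finite_def\<close>)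
  then show "laplace_map (F + G) p = (laplace_map F + laplace_map G) p"
    unfolding p laplace_map_def using assms by (simp add: distrib_right Sum_any.distrib)
qed

lemma laplace_map_scale:
  fixes F :: "'d::finite expr"
  assumes "F \<in> log_finite"
  shows "laplace_map (scale c F) = scale c (laplace_map F)"
proof
  fix p :: "(complex ^ 'd) \<times> (nat ^ 'd)"
  obtain \<delta> m where p: "p = (\<delta>, m)" by (cases p)
  have "finite {k. F (reflect \<delta>, k) * laplace_coeff (reflect \<delta>) k m \<noteq> 0}"
    by (rule finite_subset[of _ "{k. F (reflect \<delta>, k) \<noteq> 0}"]) (use assms in \<open>auto simp: log_finite_def\<close>)
  then show "laplace_map (scale c F) p = scale c (laplace_map F) p"
    unfolding p laplace_map_def scale_def by (simp add: Sum_any_right_distrib mult.assoc)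
qed

lemma laplace_map_sum:
  assumes "\<And>i. i \<in> I \<Longrightarrow> F i \<in> log_finite"
  shows "laplace_map (\<Sum>i\<in>I. F i) = (\<Sum>i\<in>I. laplace_map (F i))"
proof -
  have zero: "laplace_map 0 = 0"
    by (rule ext) (simp add: laplace_map_def case_prod_unfold)
  show ?thesis
    using assms by (induction I rule: infinite_finite_induct)
      (auto simp: zero laplace_map_add log_finite_sum)
qed

lemma laplace_coeff_diag_nonzero:
  assumes "\<gamma> \<in> nonint_rat_vecs"
  shows "laplace_coeff \<gamma> k k \<noteq> 0"
proof -
  have "Gamma (\<gamma> $ i + 1) \<noteq> 0" for i
  proof -
    have "\<gamma> $ i + of_int 1 \<in> \<rat> - \<int>" using assms by (intro rat_nonint_shift) (auto simp: nonint_rat_vecs_iff)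
    from rat_nonint_not_nonpos_Int[OF this] show ?thesis by (simp add: Gamma_eq_zero_iff)
  qed
  then show ?thesis unfolding laplace_coeff_def by simp
qed

lemma laplace_coeff_nonzero_imp_le:
  fixes k m :: "nat ^ 'd::finite"
  assumes "laplace_coeff \<gamma> k m \<noteq> 0"
  shows "m $ i \<le> k $ i"
proof (rule ccontr)
  assume "\<not> m $ i \<le> k $ i"
  then have "laplace_coeff \<gamma> k m = 0" unfolding laplace_coeff_def by (intro prod_zero bexI[of _ i]) auto
  then show False using assms by contradiction
qed

text \<open>For a fixed exponent \<open>\<gamma>\<close> the transform is triangular in the powers of the logarithms: the
  coefficient at a power \<open>k\<close> of maximal degree receives only the contribution of \<open>k\<close> itself,
  multiplied by \<open>\<plusminus> Gamma(\<gamma>\<^sub>1 + 1) ... Gamma(\<gamma>\<^sub>d + 1)\<close>, which is not zero.\<close>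

lemma laplace_map_kernel:
  fixes H :: "'d::finite expr"
  assumes H: "H \<in> log_finite" and zero: "laplace_map H = 0"
  shows "H = 0"
proof (rule ccontr)
  assume "H \<noteq> 0"
  then obtain p where "H p \<noteq> 0" by (auto simp: fun_eq_iff)
  then obtain \<gamma> k0 where "H (\<gamma>, k0) \<noteq> 0" by (cases p) auto
  define S where "S = {k. H (\<gamma>, k) \<noteq> 0}"
  have S: "finite S" "S \<noteq> {}" and \<gamma>: "\<gamma> \<in> nonint_rat_vecs"
    using H \<open>H (\<gamma>, k0) \<noteq> 0\<close> unfolding S_def log_finite_def by auto
  have "Max (mdeg ` S) \<in> mdeg ` S" using S by (intro Max_in) auto
  then obtain k where k: "k \<in> S" "mdeg k = Max (mdeg ` S)" by auto
  have max: "mdeg k' \<le> mdeg k" if "k' \<in> S" for k' using that S(1) unfolding k(2) by simp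
  have other: "H (\<gamma>, k') * laplace_coeff \<gamma> k' k = 0" if "k' \<noteq> k" for k'
  proof (rule ccontr)
    assume nz: "H (\<gamma>, k') * laplace_coeff \<gamma> k' k \<noteq> 0"
    then have le: "k $ i \<le> k' $ i" for i by (intro laplace_coeff_nonzero_imp_le[of \<gamma>]) auto
    have "\<exists>i. k' $ i \<noteq> k $ i" using that by (simp add: vec_eq_iff)
    then obtain i where "k' $ i \<noteq> k $ i" by blast
    then have "k $ i < k' $ i" using le[of i] by simp
    then have "mdeg k < mdeg k'" unfolding mdeg_def using le by (intro sum_strict_mono_ex1) auto
    moreover have "k' \<in> S" using nz unfolding S_def by simp
    ultimately show False using max[of k'] by simp
  qed
  have "laplace_map H (reflect \<gamma>, k) = H (\<gamma>, k) * laplace_coeff \<gamma> k k"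
    unfolding laplace_map_def using other by (simp add: Sum_any_eq_single[of k])
  then show False using zero k(1) laplace_coeff_diag_nonzero[OF \<gamma>] unfolding S_def by simp
qed

lemma inj_on_laplace_map: "inj_on laplace_map (log_finite :: 'd::finite expr set)"
proof (rule inj_onI)
  fix F G :: "'d expr"
  assume FG: "F \<in> log_finite" "G \<in> log_finite" "laplace_map F = laplace_map G"
  define H where "H = F + scale (- 1) G"
  have "H \<in> log_finite" unfolding H_def using FG by (intro log_finite_add log_finite_scale)
  moreover have "laplace_map H = laplace_map F + scale (- 1) (laplace_map G)"
    unfolding H_def using FG(1,2) by (simp add: laplace_map_add laplace_map_scale log_finite_scale)
  then have "laplace_map H = 0" unfolding FG(3) by (simp add: fun_eq_iff scale_def)
  ultimately have "H = 0" by (rule laplace_map_kernel)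
  then show "F = G" unfolding H_def by (simp add: fun_eq_iff scale_def)
qed

section \<open>The image of the Laplace transform\<close>

lemma expr_vector_space: "vector_space (scale :: complex \<Rightarrow> ('a \<Rightarrow> complex) \<Rightarrow> 'a \<Rightarrow> complex)"
  by unfold_locales (simp_all add: scale_def fun_eq_iff algebra_simps)

text \<open>\<open>complexify V\<close> is the span of \<open>V\<close> in the complex vector space of all expressions.\<close>

lemma complexify_base: "F \<in> V \<Longrightarrow> F \<in> complexify V"
  and complexify_add: "F \<in> complexify V \<Longrightarrow> G \<in> complexify V \<Longrightarrow> F + G \<in> complexify V"
  and complexify_scale: "F \<in> complexify V \<Longrightarrow> scale c F \<in> complexify V"
  and complexify_sum: "(\<And>i. i \<in> I \<Longrightarrow> f i \<in> complexify V) \<Longrightarrow> (\<Sum>i\<in>I. f i) \<in> complexify V"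
proof -
  interpret E: vector_space "scale :: complex \<Rightarrow> 'a expr \<Rightarrow> 'a expr" by (rule expr_vector_space)
  have eq: "complexify V = E.span V" unfolding complexify_def E.span_explicit by blast
  show "F \<in> V \<Longrightarrow> F \<in> complexify V"
    and "F \<in> complexify V \<Longrightarrow> G \<in> complexify V \<Longrightarrow> F + G \<in> complexify V"
    and "F \<in> complexify V \<Longrightarrow> scale c F \<in> complexify V"
    and "(\<And>i. i \<in> I \<Longrightarrow> f i \<in> complexify V) \<Longrightarrow> (\<Sum>i\<in>I. f i) \<in> complexify V"
    unfolding eq by (auto intro: E.span_base E.span_add E.span_scale E.span_sum)
qed

lemma times_h_in_NGA:
  assumes "g \<in> S" "\<gamma> \<in> nonint_rat_vecs"
  shows "times_h g \<gamma> k \<in> NGA S"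
  unfolding NGA_def using assms
  by (intro CollectI exI[of _ "\<lambda>_. g"] exI[of _ "{(\<gamma>, k)}"]) auto

definition signed :: "int \<Rightarrow> int ^ 'd::finite \<Rightarrow> int ^ 'd" where
  "signed e \<beta> = (\<chi> i. e * \<beta> $ i)"

text \<open>Series in \<open>x\<close> for \<open>e = 1\<close> and in \<open>1/x\<close> for \<open>e = -1\<close>. The sign \<open>e\<close> is also the change of the Gevrey
  order under the Laplace transform, which lets both halves of the theorem share one proof.\<close>

definition signed_gevrey :: "int \<Rightarrow> complex set \<Rightarrow> rat \<Rightarrow> 'd::finite series set" where
  "signed_gevrey e K s = {\<lambda>\<beta>. series_of_coeffs a (signed e \<beta>) |a. a \<in> gevrey_coeffs K s}"

lemma signed_gevrey_1: "signed_gevrey 1 K s = (gevrey K s :: 'd::finite series set)"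
proof -
  have "signed 1 \<beta> = \<beta>" for \<beta> :: "int ^ 'd" by (simp add: signed_def vec_eq_iff)
  then show ?thesis unfolding signed_gevrey_def gevrey_def by auto
qed

lemma signed_gevrey_minus_1: "signed_gevrey (- 1) K s = (gevrey_inv K s :: 'd::finite series set)"
proof -
  have "signed (- 1) \<beta> = - \<beta>" for \<beta> :: "int ^ 'd" by (simp add: signed_def vec_eq_iff)
  then show ?thesis unfolding signed_gevrey_def gevrey_inv_def gevrey_def by auto
qed

text \<open>A \<open>G_bounded\<close> factor gives again an arithmetic Gevrey series over \<open>K\<close>, and everything in sight is
  linear in the factor, so complex combinations of such factors land in the complexification.\<close>

lemma times_h_G_span_in_complexify:
  fixes a :: "nat ^ 'd::finite \<Rightarrow> complex"
  assumes K: "number_field K" and a: "a \<in> gevrey_coeffs K s" and \<gamma>: "\<gamma> \<in> nonint_rat_vecs"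
    and R: "G_span mdeg R"
  shows "times_h (\<lambda>\<beta>. series_of_coeffs (\<lambda>\<alpha>. a \<alpha> * (of_nat (mfact \<alpha>) powi e * R \<alpha>)) (signed e' \<beta>)) \<gamma> k
    \<in> complexify (NGA (signed_gevrey e' K (s + of_int e)))"
  using R
proof induction
  case (G_span_base r)
  then show ?case
    using gevrey_coeffs_mult[OF K a, of r e] \<gamma> unfolding signed_gevrey_def
    by (intro complexify_base times_h_in_NGA) auto
next
  case (G_span_add f g)
  have "(\<lambda>\<beta>. series_of_coeffs (\<lambda>\<alpha>. a \<alpha> * (of_nat (mfact \<alpha>) powi e * (f \<alpha> + g \<alpha>))) (signed e' \<beta>)) =
    (\<lambda>\<beta>. series_of_coeffs (\<lambda>\<alpha>. a \<alpha> * (of_nat (mfact \<alpha>) powi e * f \<alpha>)) (signed e' \<beta>) +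
      series_of_coeffs (\<lambda>\<alpha>. a \<alpha> * (of_nat (mfact \<alpha>) powi e * g \<alpha>)) (signed e' \<beta>))"
    by (rule ext) (simp add: series_of_coeffs_def algebra_simps)
  then show ?case using complexify_add[OF G_span_add.IH] by (simp only: times_h_add)
next
  case (G_span_cmult f c)
  have "(\<lambda>\<beta>. series_of_coeffs (\<lambda>\<alpha>. a \<alpha> * (of_nat (mfact \<alpha>) powi e * (c * f \<alpha>))) (signed e' \<beta>)) =
    (\<lambda>\<beta>. c * series_of_coeffs (\<lambda>\<alpha>. a \<alpha> * (of_nat (mfact \<alpha>) powi e * f \<alpha>)) (signed e' \<beta>))"
    by (rule ext) (simp add: series_of_coeffs_def algebra_simps)
  then show ?case using complexify_scale[OF G_span_cmult.IH, of c] by (simp only: times_h_cmult)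
qed

text \<open>The coefficient is a product over the variables of derivatives of Gamma at \<open>\<gamma>\<^sub>i + 1 + e \<alpha>\<^sub>i\<close>; the
  factorials of its factors combine to \<open>\<alpha>!\<close>.\<close>

lemma laplace_coeff_G_span:
  fixes \<gamma> :: "complex ^ 'd::finite" and e :: int
  assumes \<gamma>: "\<gamma> \<in> nonint_rat_vecs" and e: "\<bar>e\<bar> = 1"
  obtains R where "G_span mdeg R"
    "\<And>\<alpha>. laplace_coeff (shift \<gamma> (\<chi> i. e * int (\<alpha> $ i))) k m = of_nat (mfact \<alpha>) powi e * R \<alpha>"
proof -
  define R where "R = (\<lambda>\<alpha> :: nat ^ 'd. \<Prod>i\<in>UNIV. (if m $ i \<le> k $ i then of_nat (k $ i choose m $ i) * (- 1) ^ (m $ i) else 0) *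
    ((deriv ^^ (k $ i - m $ i)) Gamma (\<gamma> $ i + 1 + of_int (e * int (\<alpha> $ i))) / fact (\<alpha> $ i) powi e))"
  have "G_span mdeg R"
    unfolding R_def
  proof (intro G_span_prod G_span_mult G_span_const)
    fix i
    have z: "\<gamma> $ i + 1 \<in> \<rat> - \<int>"
      using \<gamma> rat_nonint_shift[of "\<gamma> $ i" 1] by (simp add: nonint_rat_vecs_iff)
    have "\<alpha> $ i \<le> mdeg \<alpha>" for \<alpha> :: "nat ^ 'd"
      using member_le_sum[of i UNIV "\<lambda>i. \<alpha> $ i"] unfolding mdeg_def by simp
    then show "G_span mdeg (\<lambda>\<alpha> :: nat ^ 'd. (deriv ^^ (k $ i - m $ i)) Gamma (\<gamma> $ i + 1 + of_int (e * int (\<alpha> $ i))) /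
        fact (\<alpha> $ i) powi e)"
      by (rule G_span_pullback[OF G_span_higher_deriv_Gamma[OF z e]])
  qed
  moreover have "laplace_coeff (shift \<gamma> (\<chi> i. e * int (\<alpha> $ i))) k m = of_nat (mfact \<alpha>) powi e * R \<alpha>" for \<alpha>
  proof -
    have "of_nat (mfact \<alpha>) powi e = (\<Prod>i\<in>UNIV. (fact (\<alpha> $ i) :: complex) powi e)"
      using e by (cases rule: abs_eq_1_cases)
        (simp_all add: mfact_def power_int_minus prod_inversef [symmetric, unfolded o_def])
    then have "of_nat (mfact \<alpha>) powi e * R \<alpha> = (\<Prod>i\<in>UNIV. fact (\<alpha> $ i) powi e *
        ((if m $ i \<le> k $ i then of_nat (k $ i choose m $ i) * (- 1) ^ (m $ i) else 0) *
        ((deriv ^^ (k $ i - m $ i)) Gamma (\<gamma> $ i + 1 + of_int (e * int (\<alpha> $ i))) / fact (\<alpha> $ i) powi e)))"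
      unfolding R_def by (simp only: prod.distrib)
    also have "\<dots> = laplace_coeff (shift \<gamma> (\<chi> i. e * int (\<alpha> $ i))) k m"
      unfolding laplace_coeff_def
    proof (rule prod.cong)
      fix i
      have "shift \<gamma> (\<chi> i. e * int (\<alpha> $ i)) $ i + 1 = \<gamma> $ i + 1 + of_int (e * int (\<alpha> $ i))"
        by (simp add: shift_def)
      moreover have "(fact (\<alpha> $ i) :: complex) powi e \<noteq> 0" by simp
      ultimately show "fact (\<alpha> $ i) powi e *
        ((if m $ i \<le> k $ i then of_nat (k $ i choose m $ i) * (- 1) ^ (m $ i) else 0) *
        ((deriv ^^ (k $ i - m $ i)) Gamma (\<gamma> $ i + 1 + of_int (e * int (\<alpha> $ i))) / fact (\<alpha> $ i) powi e)) =
        (if m $ i \<le> k $ i then of_nat (k $ i choose m $ i) *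
          (deriv ^^ (k $ i - m $ i)) Gamma (shift \<gamma> (\<chi> i. e * int (\<alpha> $ i)) $ i + 1) * (- 1) ^ (m $ i) else 0)"
        by (simp only: split: if_split) simp
    qed simp
    finally show ?thesis by simp
  qed
  ultimately show ?thesis by (rule that)
qed

text \<open>Sort the transform by powers of logarithms. Each power \<open>m \<le> k\<close> is multiplied by one series, in the
  inverse variables because exponents change sign.\<close>

lemma laplace_times_h_decompose:
  fixes a :: "nat ^ 'd::finite \<Rightarrow> complex"
  assumes e: "\<bar>e\<bar> = 1"
  shows "laplace_times_h (\<lambda>\<beta>. series_of_coeffs a (signed e \<beta>)) \<gamma> k =
    (\<Sum>m | \<forall>i. m $ i \<le> k $ i. times_h (\<lambda>\<beta>. series_of_coeffs (\<lambda>\<alpha>. a \<alpha> *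
        laplace_coeff (shift \<gamma> (\<chi> i. e * int (\<alpha> $ i))) k m) (signed (- e) \<beta>)) (reflect \<gamma>) m)"
  (is "?L = (\<Sum>m\<in>?M. times_h (?g m) _ m)")
proof
  fix p :: "(complex ^ 'd) \<times> (nat ^ 'd)"
  obtain \<delta> n where p: "p = (\<delta>, n)" by (cases p)
  have "?M \<subseteq> {m. mdeg m \<le> mdeg k}" unfolding mdeg_def by (auto intro: sum_mono)
  then have M: "finite ?M" using finite_mdeg_le finite_subset by blast
  show "?L p = (\<Sum>m\<in>?M. times_h (?g m) (reflect \<gamma>) m) p"
  proof (cases "\<delta> \<in> range (shift (reflect \<gamma>))")
    case False
    then have "reflect \<delta> \<notin> range (shift \<gamma>)"
    proof (rule contrapos_nn)
      assume "reflect \<delta> \<in> range (shift \<gamma>)"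
      then obtain \<beta> where "reflect \<delta> = shift \<gamma> \<beta>" by blast
      then have "\<delta> = shift (reflect \<gamma>) (- \<beta>)" by (simp add: reflect_eq_iff reflect_shift)
      then show "\<delta> \<in> range (shift (reflect \<gamma>))" by blast
    qed
    then show ?thesis using False unfolding p sum_apply_fun
      by (simp add: laplace_times_h_outside times_h_outside)
  next
    case True
    then obtain \<beta>' where "\<delta> = shift (reflect \<gamma>) \<beta>'" by auto
    then have \<beta>: "\<delta> = shift (reflect \<gamma>) (- (- \<beta>'))" by simp
    define \<beta> where "\<beta> = - \<beta>'"
    note \<beta> = \<beta>[folded \<beta>_def]
    have 1: "?L p = series_of_coeffs a (signed e \<beta>) * laplace_coeff (shift \<gamma> \<beta>) k n"
      unfolding p \<beta> reflect_shift [symmetric] by (rule laplace_times_h_reflect_shift)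
    have "(\<Sum>m\<in>?M. times_h (?g m) (reflect \<gamma>) m) p = (\<Sum>m\<in>?M. if m = n then ?g n (- \<beta>) else 0)"
      unfolding p \<beta> sum_apply_fun times_h_shift by (rule sum.cong) auto
    also have "\<dots> = (if n \<in> ?M then ?g n (- \<beta>) else 0)" using M by (simp add: sum.delta')
    also have "?g n (- \<beta>) = series_of_coeffs a (signed e \<beta>) * laplace_coeff (shift \<gamma> \<beta>) k n"
    proof -
      have "signed (- e) (- \<beta>) = signed e \<beta>" by (simp add: signed_def vec_eq_iff)
      moreover have "(\<chi> i. e * int ((\<chi> i. nat (signed e \<beta> $ i)) $ i)) = \<beta>" if "\<forall>i. 0 \<le> signed e \<beta> $ i"
      proof -
        have "e * e = 1" using e by (cases rule: abs_eq_1_cases) auto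
        then have "e * (e * x) = x" for x by (metis mult.assoc mult_1)
        then show ?thesis using that by (simp add: vec_eq_iff signed_def)
      qed
      ultimately show ?thesis by (auto simp: series_of_coeffs_def)
    qed
    also have "(if n \<in> ?M then series_of_coeffs a (signed e \<beta>) * laplace_coeff (shift \<gamma> \<beta>) k n else 0) = ?L p"
      unfolding 1 using laplace_coeff_nonzero_imp_le by fastforce
    finally show ?thesis by simp
  qed
qed

lemma laplace_times_h_in_complexify:
  fixes g :: "'d::finite series"
  assumes K: "number_field K" and e: "\<bar>e\<bar> = 1" and g: "g \<in> signed_gevrey e K s"
    and \<gamma>: "\<gamma> \<in> nonint_rat_vecs"
  shows "laplace_times_h g \<gamma> k \<in> complexify (NGA (signed_gevrey (- e) K (s + of_int e)))"
proof -
  obtain a where a: "a \<in> gevrey_coeffs K s" "g = (\<lambda>\<beta>. series_of_coeffs a (signed e \<beta>))"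
    using g unfolding signed_gevrey_def by blast
  show ?thesis
    unfolding a(2) laplace_times_h_decompose[OF e]
  proof (rule complexify_sum)
    fix m
    obtain R where R: "G_span mdeg R"
      "\<And>\<alpha>. laplace_coeff (shift \<gamma> (\<chi> i. e * int (\<alpha> $ i))) k m = of_nat (mfact \<alpha>) powi e * R \<alpha>"
      by (rule laplace_coeff_G_span[OF \<gamma> e]) (rule that)
    show "times_h (\<lambda>\<beta>. series_of_coeffs (\<lambda>\<alpha>. a \<alpha> *
        laplace_coeff (shift \<gamma> (\<chi> i. e * int (\<alpha> $ i))) k m) (signed (- e) \<beta>)) (reflect \<gamma>) m
      \<in> complexify (NGA (signed_gevrey (- e) K (s + of_int e)))"
      unfolding R(2) using K a(1) reflect_nonint_rat_vecs[OF \<gamma>] R(1)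
      by (rule times_h_G_span_in_complexify)
  qed
qed

lemma laplace_map_signed_gevrey:
  fixes e :: int
  assumes K: "number_field K" and e: "\<bar>e\<bar> = 1"
  shows "\<exists>\<Phi> :: 'd::finite expr \<Rightarrow> 'd expr.
            induced_by_laplace (signed_gevrey e K s) \<Phi> \<and>
            linear_over K (NGA (signed_gevrey e K s)) \<Phi> \<and>
            \<Phi> ` NGA (signed_gevrey e K s) \<subseteq> complexify (NGA (signed_gevrey (- e) K (s + of_int e))) \<and>
            inj_on \<Phi> (NGA (signed_gevrey e K s))"
proof (intro exI conjI)
  have sum: "laplace_map (\<Sum>(\<gamma>, k)\<in>I. times_h (f (\<gamma>, k)) \<gamma> k) = (\<Sum>(\<gamma>, k)\<in>I. laplace_times_h (f (\<gamma>, k)) \<gamma> k)"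
    if "I \<subseteq> nonint_rat_vecs \<times> UNIV" for f :: "(complex ^ 'd) \<times> (nat ^ 'd) \<Rightarrow> 'd series" and I
  proof -
    have "laplace_map (\<Sum>(\<gamma>, k)\<in>I. times_h (f (\<gamma>, k)) \<gamma> k) =
        (\<Sum>p\<in>I. laplace_map (case p of (\<gamma>, k) \<Rightarrow> times_h (f (\<gamma>, k)) \<gamma> k))"
      using that by (intro laplace_map_sum) (auto intro: times_h_log_finite)
    also have "\<dots> = (\<Sum>(\<gamma>, k)\<in>I. laplace_times_h (f (\<gamma>, k)) \<gamma> k)"
      by (intro sum.cong) (auto simp: laplace_map_times_h)
    finally show ?thesis .
  qed
  show "induced_by_laplace (signed_gevrey e K s) (laplace_map :: 'd expr \<Rightarrow> 'd expr)"
    unfolding induced_by_laplace_def using sum by blast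
  show "linear_over K (NGA (signed_gevrey e K s)) (laplace_map :: 'd expr \<Rightarrow> 'd expr)"
    unfolding linear_over_def using NGA_subset_log_finite laplace_map_add laplace_map_scale by blast
  show "inj_on laplace_map (NGA (signed_gevrey e K s) :: 'd expr set)"
    using inj_on_laplace_map NGA_subset_log_finite by (rule inj_on_subset)
  show "laplace_map ` NGA (signed_gevrey e K s) \<subseteq>
      complexify (NGA (signed_gevrey (- e) K (s + of_int e)) :: 'd expr set)"
  proof
    fix G assume "G \<in> laplace_map ` (NGA (signed_gevrey e K s) :: 'd expr set)"
    then obtain f :: "(complex ^ 'd) \<times> (nat ^ 'd) \<Rightarrow> 'd series" and I where
      fI: "I \<subseteq> nonint_rat_vecs \<times> UNIV" "\<forall>p\<in>I. f p \<in> signed_gevrey e K s"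
        "G = laplace_map (\<Sum>(\<gamma>, k)\<in>I. times_h (f (\<gamma>, k)) \<gamma> k)"
      unfolding NGA_def by blast
    show "G \<in> complexify (NGA (signed_gevrey (- e) K (s + of_int e)))"
      unfolding fI(3) sum[OF fI(1)] using fI(1,2)
      by (intro complexify_sum) (auto intro!: laplace_times_h_in_complexify[OF K e])
  qed
qed

theorem proposition3p8:
  fixes K :: "complex set" and s :: rat
  assumes "number_field K"
  shows "(\<exists>\<Phi> :: 'd::finite expr \<Rightarrow> 'd expr.
            induced_by_laplace (gevrey K s) \<Phi> \<and>
            linear_over K (NGA (gevrey K s)) \<Phi> \<and>
            \<Phi> ` NGA (gevrey K s) \<subseteq> complexify (NGA (gevrey_inv K (s + 1))) \<and>
            inj_on \<Phi> (NGA (gevrey K s))) \<and>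
         (\<exists>\<Psi> :: 'd expr \<Rightarrow> 'd expr.
            induced_by_laplace (gevrey_inv K s) \<Psi> \<and>
            linear_over K (NGA (gevrey_inv K s)) \<Psi> \<and>
            \<Psi> ` NGA (gevrey_inv K s) \<subseteq> complexify (NGA (gevrey K (s - 1))) \<and>
            inj_on \<Psi> (NGA (gevrey_inv K s)))"
  using laplace_map_signed_gevrey[OF assms, of 1 s, where 'd='d]
    laplace_map_signed_gevrey[OF assms, of "- 1" s, where 'd='d]
  by (simp add: signed_gevrey_1 signed_gevrey_minus_1)

end
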